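(* For every continuous function $f : \mathbb{T} \to \mathbb{R}$, the almost sure essential spectrum $\Sigma_f \subseteq \mathbb{R}$ of the doubling map model with sampling function $f$ is connected.
   Context: $\mathbb{T} = \mathbb{R}/\mathbb{Z}$, $\mathbb{Z}_+ = \{0,1,2,\dots\}$, and $\mu$ is Lebesgue (Haar probability) measure on $\mathbb{T}$. Given $f \in C(\mathbb{T},\mathbb{R})$ and $\omega \in \mathbb{T}$, the doubling map model is the bounded self-adjoint half-line discrete Schrödinger operator $H_\omega$ on $\ell^2(\mathbb{Z}_+)$ given by $$[H_\omega \psi](n) = \psi(n+1) + \psi(n-1) + f(2^n \omega)\psi(n), \quad n \ge 0,$$ with the boundary condition $\psi(-1) = 0$. It is a known fact that there is a set $\Sigma_f \subseteq \mathbb{R}$ such that $\sigma_{\mathrm{ess}}(H_\omega) = \Sigma_f$ for $\mu$-almost every $\omega \in \mathbb{T}$, where $\sigma_{\mathrm{ess}}$ denotes the essential spectrum; this $\Sigma_f$ is called the almost sure essential spectrum of the doubling map model. *)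

theory Defs
  imports "HOL-Analysis.Analysis"
begin

section \<open>The complex Hilbert space of square-summable sequences\<close>

definition square_summable :: "(nat \<Rightarrow> complex) \<Rightarrow> bool" where
  "square_summable \<psi> \<longleftrightarrow> summable (\<lambda>n. (cmod (\<psi> n))\<^sup>2)"

definition l2norm :: "(nat \<Rightarrow> complex) \<Rightarrow> real" where
  "l2norm \<psi> = sqrt (\<Sum>n. (cmod (\<psi> n))\<^sup>2)"

lemma L2_set_le_l2norm:
  assumes "square_summable \<psi>"
  shows "L2_set (\<lambda>n. cmod (\<psi> n)) {..<N} \<le> l2norm \<psi>"
  using assms unfolding square_summable_def L2_set_def l2norm_def
  by (auto intro!: sum_le_suminf)

lemma square_summableI:
  assumes "\<And>N. L2_set (\<lambda>n. cmod (\<psi> n)) {..<N} \<le> C"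
  shows "square_summable \<psi>" and "l2norm \<psi> \<le> C"
proof -
  have C: "0 \<le> C"
    using assms[of 0] by simp
  have partial: "(\<Sum>n<N. (cmod (\<psi> n))\<^sup>2) \<le> C\<^sup>2" for N
    using assms[of N] unfolding L2_set_def by (rule sqrt_le_D)
  show *: "square_summable \<psi>"
    unfolding square_summable_def
    by (rule summableI_nonneg_bounded[where x = "C\<^sup>2"]) (use partial in auto)
  have "(\<Sum>n. (cmod (\<psi> n))\<^sup>2) \<le> C\<^sup>2"
    by (rule suminf_le_const) (use * partial in \<open>auto simp: square_summable_def\<close>)
  then show "l2norm \<psi> \<le> C"
    unfolding l2norm_def using C by (simp add: real_le_lsqrt)
qed

lemma square_summable_add:
  assumes "square_summable \<phi>" and "square_summable \<psi>"
  shows "square_summable (\<lambda>n. \<phi> n + \<psi> n)"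
    and "l2norm (\<lambda>n. \<phi> n + \<psi> n) \<le> l2norm \<phi> + l2norm \<psi>"
proof -
  have "L2_set (\<lambda>n. cmod (\<phi> n + \<psi> n)) {..<N} \<le> l2norm \<phi> + l2norm \<psi>" for N
  proof -
    have "L2_set (\<lambda>n. cmod (\<phi> n + \<psi> n)) {..<N}
        \<le> L2_set (\<lambda>n. cmod (\<phi> n) + cmod (\<psi> n)) {..<N}"
      by (rule L2_set_mono) (auto intro: norm_triangle_ineq)
    also have "\<dots> \<le> L2_set (\<lambda>n. cmod (\<phi> n)) {..<N} + L2_set (\<lambda>n. cmod (\<psi> n)) {..<N}"
      by (rule L2_set_triangle_ineq)
    also have "\<dots> \<le> l2norm \<phi> + l2norm \<psi>"
      by (intro add_mono L2_set_le_l2norm assms)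
    finally show ?thesis .
  qed
  from square_summableI[OF this]
  show "square_summable (\<lambda>n. \<phi> n + \<psi> n)"
    and "l2norm (\<lambda>n. \<phi> n + \<psi> n) \<le> l2norm \<phi> + l2norm \<psi>" by auto
qed

lemma square_summable_bounded_mult:
  assumes "square_summable \<psi>" and "\<And>n. cmod (b n) \<le> C"
  shows "square_summable (\<lambda>n. b n * \<psi> n)" and "l2norm (\<lambda>n. b n * \<psi> n) \<le> C * l2norm \<psi>"
proof -
  have C: "0 \<le> C"
    using norm_ge_zero[of "b 0"] assms(2)[of 0] by linarith
  have "L2_set (\<lambda>n. cmod (b n * \<psi> n)) {..<N} \<le> C * l2norm \<psi>" for N
  proof -
    have "L2_set (\<lambda>n. cmod (b n * \<psi> n)) {..<N} \<le> L2_set (\<lambda>n. C * cmod (\<psi> n)) {..<N}"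
      by (rule L2_set_mono) (auto simp: norm_mult intro!: mult_right_mono assms)
    also have "\<dots> = C * L2_set (\<lambda>n. cmod (\<psi> n)) {..<N}"
      by (rule L2_set_right_distrib[OF C, symmetric])
    also have "\<dots> \<le> C * l2norm \<psi>"
      by (intro mult_left_mono L2_set_le_l2norm assms C)
    finally show ?thesis .
  qed
  from square_summableI[OF this]
  show "square_summable (\<lambda>n. b n * \<psi> n)" and "l2norm (\<lambda>n. b n * \<psi> n) \<le> C * l2norm \<psi>"
    by auto
qed

lemma square_summable_scale:
  "square_summable \<psi> \<Longrightarrow> square_summable (\<lambda>n. c * \<psi> n)"
  by (rule square_summable_bounded_mult(1)[where C = "cmod c"]) auto

lemma l2norm_scale:
  assumes "square_summable \<psi>"
  shows "l2norm (\<lambda>n. c * \<psi> n) = cmod c * l2norm \<psi>"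
  using assms unfolding square_summable_def l2norm_def
  by (simp add: norm_mult power_mult_distrib suminf_mult real_sqrt_mult)

lemma square_summable_zero: "square_summable (\<lambda>_. 0)"
  by (simp add: square_summable_def)

lemma square_summable_minus: "square_summable \<psi> \<Longrightarrow> square_summable (\<lambda>n. - \<psi> n)"
  by (simp add: square_summable_def)

typedef ell2 = "{\<psi>. square_summable \<psi>}"
  morphisms coord Abs_ell2
  using square_summable_zero by blast

setup_lifting type_definition_ell2

lemma square_summable_coord: "square_summable (coord \<psi>)"
  using coord[of \<psi>] by simp

lemma coord_Abs_ell2: "square_summable \<psi> \<Longrightarrow> coord (Abs_ell2 \<psi>) = \<psi>"
  by (simp add: Abs_ell2_inverse)

lift_definition cscale :: "complex \<Rightarrow> ell2 \<Rightarrow> ell2" (infixr "*\<^sub>\<complex>" 75)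
  is "\<lambda>c \<psi> n. c * \<psi> n"
  by (simp add: square_summable_scale)

instantiation ell2 :: real_normed_vector
begin

lift_definition zero_ell2 :: ell2 is "\<lambda>_. 0"
  by (simp add: square_summable_zero)

lift_definition plus_ell2 :: "ell2 \<Rightarrow> ell2 \<Rightarrow> ell2" is "\<lambda>\<phi> \<psi> n. \<phi> n + \<psi> n"
  by (simp add: square_summable_add)

lift_definition uminus_ell2 :: "ell2 \<Rightarrow> ell2" is "\<lambda>\<psi> n. - \<psi> n"
  by (simp add: square_summable_minus)

lift_definition minus_ell2 :: "ell2 \<Rightarrow> ell2 \<Rightarrow> ell2" is "\<lambda>\<phi> \<psi> n. \<phi> n - \<psi> n"
  using square_summable_add(1) square_summable_minus by fastforce

definition scaleR_ell2 :: "real \<Rightarrow> ell2 \<Rightarrow> ell2" where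
  "scaleR_ell2 r \<psi> = complex_of_real r *\<^sub>\<complex> \<psi>"

lift_definition norm_ell2 :: "ell2 \<Rightarrow> real" is l2norm .

definition dist_ell2 :: "ell2 \<Rightarrow> ell2 \<Rightarrow> real" where
  "dist_ell2 \<phi> \<psi> = norm (\<phi> - \<psi>)"

definition sgn_ell2 :: "ell2 \<Rightarrow> ell2" where
  "sgn_ell2 \<psi> = inverse (norm \<psi>) *\<^sub>R \<psi>"

definition uniformity_ell2 :: "(ell2 \<times> ell2) filter" where
  "uniformity_ell2 = (INF e\<in>{0<..}. principal {(\<phi>, \<psi>). dist \<phi> \<psi> < e})"

definition open_ell2 :: "ell2 set \<Rightarrow> bool" where
  "open_ell2 U = (\<forall>\<phi>\<in>U. \<forall>\<^sub>F (\<phi>', \<psi>) in uniformity. \<phi>' = \<phi> \<longrightarrow> \<psi> \<in> U)"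

instance
proof
  fix \<phi> \<psi> \<eta> :: ell2 and r s :: real
  show "\<phi> + \<psi> + \<eta> = \<phi> + (\<psi> + \<eta>)" "\<phi> + \<psi> = \<psi> + \<phi>" "0 + \<phi> = \<phi>" "- \<phi> + \<phi> = 0"
    "\<phi> - \<psi> = \<phi> + - \<psi>"
    by (transfer; simp add: algebra_simps)+
  show "r *\<^sub>R (\<phi> + \<psi>) = r *\<^sub>R \<phi> + r *\<^sub>R \<psi>" "(r + s) *\<^sub>R \<phi> = r *\<^sub>R \<phi> + s *\<^sub>R \<phi>"
    "r *\<^sub>R s *\<^sub>R \<phi> = (r * s) *\<^sub>R \<phi>" "1 *\<^sub>R \<phi> = \<phi>"
    unfolding scaleR_ell2_def by (transfer; simp add: algebra_simps)+
  show "norm \<phi> = 0 \<longleftrightarrow> \<phi> = 0"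
    by transfer (auto simp: l2norm_def square_summable_def suminf_eq_zero_iff fun_eq_iff)
  show "norm (\<phi> + \<psi>) \<le> norm \<phi> + norm \<psi>"
    by transfer (simp add: square_summable_add(2))
  show "norm (r *\<^sub>R \<phi>) = \<bar>r\<bar> * norm \<phi>"
    unfolding scaleR_ell2_def by transfer (simp add: l2norm_scale)
qed (rule dist_ell2_def sgn_ell2_def uniformity_ell2_def open_ell2_def)+

end

global_interpretation ell2: vector_space cscale
  by unfold_locales (transfer; simp add: algebra_simps)+


section \<open>The essential spectrum\<close>

definition bounded_clinear_ell2 :: "(ell2 \<Rightarrow> ell2) \<Rightarrow> bool" where
  "bounded_clinear_ell2 A \<longleftrightarrow>
     bounded_linear A \<and> (\<forall>c \<psi>. A (c *\<^sub>\<complex> \<psi>) = c *\<^sub>\<complex> A \<psi>)"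

text \<open>Note that \<^term>\<open>ell2.span\<close> is the span over the complex numbers. The last conjunct says
  that the range of \<open>A\<close> has finite codimension.\<close>

definition fredholm :: "(ell2 \<Rightarrow> ell2) \<Rightarrow> bool" where
  "fredholm A \<longleftrightarrow>
     bounded_clinear_ell2 A \<and>
     (\<exists>B. finite B \<and> {\<psi>. A \<psi> = 0} \<subseteq> ell2.span B) \<and>
     closed (range A) \<and>
     (\<exists>B. finite B \<and> (\<forall>\<psi>. \<exists>\<phi>. \<psi> - A \<phi> \<in> ell2.span B))"

definition essential_spectrum :: "(ell2 \<Rightarrow> ell2) \<Rightarrow> complex set" where
  "essential_spectrum A = {z. \<not> fredholm (\<lambda>\<psi>. A \<psi> - z *\<^sub>\<complex> \<psi>)}"


section \<open>Half-line discrete Schroedinger operators and the doubling map model\<close>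

text \<open>The value \<open>0\<close> at \<open>n = 0\<close> of the second summand is the boundary condition
  \<open>\<psi>(-1) = 0\<close>.\<close>

definition schroedinger_seq :: "(nat \<Rightarrow> real) \<Rightarrow> (nat \<Rightarrow> complex) \<Rightarrow> nat \<Rightarrow> complex" where
  "schroedinger_seq V \<psi> n =
     \<psi> (n + 1) + (if n = 0 then 0 else \<psi> (n - 1)) + complex_of_real (V n) * \<psi> n"

text \<open>For a bounded potential \<open>V\<close> the use of \<^const>\<open>Abs_ell2\<close> is justified by
  \<open>coord_schroedinger\<close> below; for other \<open>V\<close> the operator is meaningless.\<close>

definition schroedinger :: "(nat \<Rightarrow> real) \<Rightarrow> ell2 \<Rightarrow> ell2" where
  "schroedinger V \<psi> = Abs_ell2 (schroedinger_seq V (coord \<psi>))"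

lemma square_summable_schroedinger_seq:
  assumes "square_summable \<psi>" and "bounded (range V)"
  shows "square_summable (schroedinger_seq V \<psi>)"
proof -
  obtain C where C: "\<And>n. cmod (complex_of_real (V n)) \<le> C"
    using assms(2) by (auto simp: bounded_iff)
  have 1: "square_summable (\<lambda>n. \<psi> (n + 1))"
    using assms(1) unfolding square_summable_def by (subst summable_iff_shift)
  have "summable (\<lambda>n. (cmod (if Suc n = 0 then 0 else \<psi> (Suc n - 1)))\<^sup>2)"
    using assms(1) by (simp add: square_summable_def)
  then have 2: "square_summable (\<lambda>n. if n = 0 then 0 else \<psi> (n - 1))"
    unfolding square_summable_def by (subst (asm) summable_Suc_iff)
  have 3: "square_summable (\<lambda>n. complex_of_real (V n) * \<psi> n)"
    by (rule square_summable_bounded_mult(1)[OF assms(1) C])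
  show ?thesis
    unfolding schroedinger_seq_def[abs_def]
    by (rule square_summable_add(1)[OF square_summable_add(1)[OF 1 2] 3])
qed

lemma coord_schroedinger:
  assumes "bounded (range V)"
  shows "coord (schroedinger V \<psi>) = schroedinger_seq V (coord \<psi>)"
  unfolding schroedinger_def
  by (intro coord_Abs_ell2 square_summable_schroedinger_seq square_summable_coord assms)

text \<open>Functions on the circle \<open>\<real>/\<int>\<close> are represented by functions on the reals with period 1,
  and a point of the circle by any of its real representatives.\<close>

definition circle_continuous :: "(real \<Rightarrow> real) \<Rightarrow> bool" where
  "circle_continuous f \<longleftrightarrow> continuous_on UNIV f \<and> (\<forall>x. f (x + 1) = f x)"

definition doubling_operator :: "(real \<Rightarrow> real) \<Rightarrow> real \<Rightarrow> ell2 \<Rightarrow> ell2" where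
  "doubling_operator f \<omega> = schroedinger (\<lambda>n. f (2 ^ n * \<omega>))"

lemma bounded_range_circle_continuous:
  assumes "circle_continuous f"
  shows "bounded (range f)"
proof -
  have per: "f (x + real n) = f x" for x n
  proof (induction n)
    case (Suc n)
    have "f (x + real (Suc n)) = f ((x + real n) + 1)"
      by (simp add: ac_simps)
    then show ?case
      using assms Suc by (simp only: circle_continuous_def)
  qed simp
  have eq: "f x = f (frac x)" for x
  proof (cases "0 \<le> \<lfloor>x\<rfloor>")
    case True
    then have "x = frac x + real (nat \<lfloor>x\<rfloor>)"
      by (simp add: frac_def)
    then show ?thesis
      using per[of "frac x" "nat \<lfloor>x\<rfloor>"] by simp
  next
    case False
    then have "frac x = x + real (nat (- \<lfloor>x\<rfloor>))"
      by (simp add: frac_def)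
    then show ?thesis
      using per[of x "nat (- \<lfloor>x\<rfloor>)"] by simp
  qed
  have "range f \<subseteq> f ` {0..1}"
  proof
    fix y
    assume "y \<in> range f"
    then obtain x where "y = f (frac x)"
      using eq by auto
    then show "y \<in> f ` {0..1}"
      using frac_ge_0[of x] frac_lt_1[of x] by (intro image_eqI[of _ _ "frac x"]) auto
  qed
  moreover have "compact (f ` {0..1})"
    using assms
    by (intro compact_continuous_image) (auto simp: circle_continuous_def intro: continuous_on_subset)
  ultimately show ?thesis
    using bounded_subset compact_imp_bounded by blast
qed

lemma coord_doubling_operator:
  assumes "circle_continuous f"
  shows "coord (doubling_operator f \<omega> \<psi>) n =
     coord \<psi> (n + 1) + (if n = 0 then 0 else coord \<psi> (n - 1))
       + complex_of_real (f (2 ^ n * \<omega>)) * coord \<psi> n"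
proof -
  have "bounded (range (\<lambda>n. f (2 ^ n * \<omega>)))"
    by (rule bounded_subset[OF bounded_range_circle_continuous[OF assms]]) auto
  then show ?thesis
    by (simp add: doubling_operator_def coord_schroedinger schroedinger_seq_def)
qed

text \<open>The unit interval \<open>[0,1)\<close> with Lebesgue measure represents the circle with Haar probability
  measure. For continuous \<open>f\<close> there is a set as described, by ergodicity of the doubling map; it is
  unique because the measure is nonzero.\<close>

definition almost_sure_essential_spectrum :: "(real \<Rightarrow> real) \<Rightarrow> real set" where
  "almost_sure_essential_spectrum f =
     (THE \<Sigma>. AE \<omega> in lebesgue_on {0..<1}.
        essential_spectrum (doubling_operator f \<omega>) = complex_of_real ` \<Sigma>)"

end

(* The spectral values of almost every operator are the approximate eigenvalues E of the translates of
   the operators along forward orbits, with test vectors supported away from the boundary. If E is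
   not such a value, then every difference equation over a forward orbit has exactly one decaying
   solution up to a factor. Its initial direction depends continuously on the point x of the circle, and
   the transfer matrix at x, which is homotopic to a constant, carries the direction at x to the one
   at 2x. So the degree d of this map from the circle to the projective line satisfies 2d = d, hence
   d = 0, and the direction has a continuous angle that is bounded along orbits. Angles move by at most
   a half turn in each step, so along any orbit the quotients of consecutive values of the decaying
   solution eventually have constant sign. By Jacobi's factorization the operator minus E is then
   semibounded far out on a dense orbit, and E has no approximate eigenvalues on one of its sides. *)

theory Submission
  imports Defs
begin

section \<open>The Hilbert space of square-summable sequences\<close>

text \<open>For E outside the spectrum there is only a lower bound, uniform over all base points x,
  on vectors that vanish at 0. A priori the half-line operator over x may still have E as an
  eigenvalue produced by the boundary, so it cannot simply be inverted. Adding \<i> times the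
  projection onto site 0 repairs this with one constant for all x, because the imaginary part of the
  quadratic form controls the entry at 0. The inverse applied to the unit vector at 0 is then the
  decaying solution: existence comes from this inverse, continuity in x from the resolvent identity,
  uniqueness up to a factor from the Wronskian. The homotopy to a constant is made explicit by an
  angle function for shears, defined through the principal logarithm, so that degrees can be
  compared by evaluating one recursion at two points. In terms of gap labelling, degree 0 leaves
  only the trivial labels.\<close>

lemma norm_ell2_sq: "(norm \<psi>)\<^sup>2 = (\<Sum>n. (cmod (coord \<psi> n))\<^sup>2)"
  using square_summable_coord[of \<psi>]
  by (simp add: norm_ell2.rep_eq l2norm_def square_summable_def suminf_nonneg)

lemma coord_simps [simp]:
  "coord (\<phi> + \<psi>) n = coord \<phi> n + coord \<psi> n"
  "coord (\<phi> - \<psi>) n = coord \<phi> n - coord \<psi> n"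
  "coord (- \<phi>) n = - coord \<phi> n"
  "coord 0 n = 0"
  "coord (c *\<^sub>\<complex> \<phi>) n = c * coord \<phi> n"
  "coord (r *\<^sub>R \<phi>) n = complex_of_real r * coord \<phi> n"
  by (simp_all add: plus_ell2.rep_eq minus_ell2.rep_eq uminus_ell2.rep_eq zero_ell2.rep_eq
      cscale.rep_eq scaleR_ell2_def)

lemma ell2_eqI: "(\<And>n. coord \<phi> n = coord \<psi> n) \<Longrightarrow> \<phi> = \<psi>"
  by (simp add: coord_inject[symmetric] ext)

lemma ell2_summable: "summable (\<lambda>n. (cmod (coord \<psi> n))\<^sup>2)"
  using square_summable_coord[of \<psi>] by (simp add: square_summable_def)

lemma norm_cscale: "norm (c *\<^sub>\<complex> \<psi>) = cmod c * norm \<psi>"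
  by transfer (simp add: l2norm_scale)

lemma sum_coord_le_norm: 
  assumes "finite S" shows "(\<Sum>n\<in>S. (cmod (coord \<psi> n))\<^sup>2) \<le> (norm \<psi>)\<^sup>2"
  unfolding norm_ell2_sq by (intro sum_le_suminf ell2_summable assms) auto

lemma cmod_coord_le_norm: "cmod (coord \<psi> n) \<le> norm \<psi>"
  using sum_coord_le_norm[of "{n}" \<psi>] by (simp add: power2_le_iff_abs_le)

lemma ell2_summable_mult: "summable (\<lambda>n. coord \<phi> n * cnj (coord \<psi> n))"
proof (rule summable_comparison_test')
  show "summable (\<lambda>n. (cmod (coord \<phi> n))\<^sup>2 + (cmod (coord \<psi> n))\<^sup>2)"
    by (intro summable_add ell2_summable)
  show "norm (coord \<phi> n * cnj (coord \<psi> n)) \<le> (cmod (coord \<phi> n))\<^sup>2 + (cmod (coord \<psi> n))\<^sup>2" for n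
    using sum_squares_bound[of "cmod (coord \<phi> n)" "cmod (coord \<psi> n)"]
      mult_nonneg_nonneg[OF norm_ge_zero norm_ge_zero, of "coord \<phi> n" "coord \<psi> n"]
    by (simp only: norm_mult complex_mod_cnj mult.assoc)
qed

instantiation ell2 :: real_inner
begin

text \<open>The real part of the Hermitian product, which makes the space a real Hilbert space; the
  imaginary part reappears as the inner product with
  \<open>\<i> *\<^sub>\<complex> \<psi>\<close>.\<close>

definition inner_ell2 :: "ell2 \<Rightarrow> ell2 \<Rightarrow> real" where
  "inner_ell2 \<phi> \<psi> = (\<Sum>n. Re (coord \<phi> n * cnj (coord \<psi> n)))"

instance
proof
  note summ = summable_Re[OF ell2_summable_mult]
  fix x y z :: ell2 and r :: real
  show "inner x y = inner y x"
    by (simp add: inner_ell2_def mult.commute)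
  show "inner (x + y) z = inner x z + inner y z"
    unfolding inner_ell2_def suminf_add[OF summ summ] by (simp add: algebra_simps)
  show "inner (r *\<^sub>R x) y = r * inner x y"
    unfolding inner_ell2_def suminf_mult[OF summ, symmetric] by (simp add: algebra_simps)
  have sq: "inner x x = (norm x)\<^sup>2" for x :: ell2
    unfolding inner_ell2_def norm_ell2_sq by (intro suminf_cong) (simp add: cmod_power2 flip: power2_eq_square)
  show "0 \<le> inner x x" "(inner x x = 0) = (x = 0)" "norm x = sqrt (inner x x)"
    by (simp_all add: sq)
qed

end

lemma inner_ell2_sums: "(\<lambda>n. Re (coord \<phi> n * cnj (coord \<psi> n))) sums inner \<phi> \<psi>"
  unfolding inner_ell2_def by (intro summable_sums summable_Re ell2_summable_mult)

lemma bounded_linear_coord: "bounded_linear (\<lambda>\<psi>. coord \<psi> n)"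
  by (rule bounded_linear_intro[of _ 1]) (simp_all add: cmod_coord_le_norm scaleR_conv_of_real)

instance ell2 :: banach
proof
  fix X :: "nat \<Rightarrow> ell2"
  assume X: "Cauchy X"
  define l where "l n = lim (\<lambda>k. coord (X k) n)" for n
  have l: "(\<lambda>k. coord (X k) n) \<longlonglongrightarrow> l n" for n
    unfolding l_def
    by (intro convergent_LIMSEQ_iff[THEN iffD1] Cauchy_convergent bounded_linear.Cauchy[OF bounded_linear_coord X])
  \<comment> \<open>One estimate on initial segments, obtained by letting \<open>i\<close> tend to
    infinity, serves both the square-summability of \<open>l\<close> and the convergence in
    norm.\<close>
  have key: "L2_set (\<lambda>n. cmod (l n - coord (X k) n)) {..<N} \<le> e"
    if M: "\<And>i j. i \<ge> M \<Longrightarrow> j \<ge> M \<Longrightarrow> norm (X i - X j) < e" and k: "k \<ge> M" for M e k N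
  proof (rule LIMSEQ_le_const2)
    show "(\<lambda>i. L2_set (\<lambda>n. cmod (coord (X i) n - coord (X k) n)) {..<N})
            \<longlonglongrightarrow> L2_set (\<lambda>n. cmod (l n - coord (X k) n)) {..<N}"
      unfolding L2_set_def by (intro tendsto_intros l)
    have "L2_set (\<lambda>n. cmod (coord (X i) n - coord (X k) n)) {..<N} \<le> e" if "i \<ge> M" for i
      using L2_set_le_l2norm[OF square_summable_coord, of "X i - X k" N] M[OF that k]
      by (simp add: norm_ell2.rep_eq)
    then show "\<exists>N'. \<forall>n\<ge>N'. L2_set (\<lambda>na. cmod (coord (X n) na - coord (X k) na)) {..<N} \<le> e"
      by blast
  qed
  have sq: "square_summable l"
  proof -
    obtain M where "\<And>i j. i \<ge> M \<Longrightarrow> j \<ge> M \<Longrightarrow> norm (X i - X j) < 1"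
      using CauchyD[OF X, of 1] by auto
    from key[OF this order_refl]
    have "square_summable (\<lambda>n. l n - coord (X M) n)"
      by (rule square_summableI(1))
    from square_summable_add(1)[OF this square_summable_coord[of "X M"]]
    show ?thesis by simp
  qed
  have "X \<longlonglongrightarrow> Abs_ell2 l"
  proof (rule LIMSEQ_I)
    fix r :: real assume r: "0 < r"
    obtain M where M: "\<And>i j. i \<ge> M \<Longrightarrow> j \<ge> M \<Longrightarrow> norm (X i - X j) < r / 2"
      using CauchyD[OF X, of "r / 2"] r by auto
    have "norm (X k - Abs_ell2 l) < r" if "k \<ge> M" for k
    proof -
      have "l2norm (\<lambda>n. l n - coord (X k) n) \<le> r / 2"
        by (rule square_summableI(2)) (rule key[OF M that])
      moreover have "coord (Abs_ell2 l - X k) = (\<lambda>n. l n - coord (X k) n)"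
        by (rule ext) (simp add: coord_Abs_ell2[OF sq])
      ultimately have "norm (Abs_ell2 l - X k) \<le> r / 2"
        by (simp add: norm_ell2.rep_eq)
      with r show ?thesis by (simp add: norm_minus_commute)
    qed
    then show "\<exists>no. \<forall>n\<ge>no. norm (X n - Abs_ell2 l) < r" by blast
  qed
  then show "convergent X" by (auto simp: convergent_def)
qed

lemma ell2_sums_coord: "F sums \<psi> \<Longrightarrow> (\<lambda>k. coord (F k) n) sums coord \<psi> n"
  by (rule bounded_linear.sums[OF bounded_linear_coord])

lemma square_summable_finite: "(\<And>n. n > L \<Longrightarrow> \<psi> n = 0) \<Longrightarrow> square_summable \<psi>"
  unfolding square_summable_def by (rule summable_finite[of "{..L}"]) auto

lift_definition unit_ell2 :: ell2 is "\<lambda>n. if n = 0 then 1 else 0"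
  by (rule square_summable_finite[of 0]) auto

lemma coord_unit [simp]: "coord unit_ell2 n = (if n = 0 then 1 else 0)"
  by (simp add: unit_ell2.rep_eq)

lemma norm_unit [simp]: "norm unit_ell2 = 1"
proof -
  have "(norm unit_ell2)\<^sup>2 = (\<Sum>n\<in>{0::nat}. (cmod (coord unit_ell2 n))\<^sup>2)"
    unfolding norm_ell2_sq by (rule suminf_finite) auto
  then show ?thesis using norm_ge_zero[of unit_ell2] by (auto simp: power2_eq_1_iff)
qed

lift_definition trunc :: "nat \<Rightarrow> ell2 \<Rightarrow> ell2" is "\<lambda>N \<psi> n. if n < N then \<psi> n else 0"
  subgoal for N by (rule square_summable_finite[of N]) simp
  done

lemma coord_trunc [simp]: "coord (trunc N \<psi>) n = (if n < N then coord \<psi> n else 0)"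
  by (simp add: trunc.rep_eq)

lemma trunc_tendsto: "(\<lambda>N. trunc N \<psi>) \<longlonglongrightarrow> \<psi>"
proof -
  have "(norm (trunc N \<psi> - \<psi>))\<^sup>2 = (\<Sum>n. (cmod (coord \<psi> (n + N)))\<^sup>2)" for N
  proof -
    have "(norm (trunc N \<psi> - \<psi>))\<^sup>2 = (\<Sum>n. (cmod (coord (trunc N \<psi> - \<psi>) (n + N)))\<^sup>2)
         + (\<Sum>n<N. (cmod (coord (trunc N \<psi> - \<psi>) n))\<^sup>2)"
      unfolding norm_ell2_sq by (rule suminf_split_initial_segment[OF ell2_summable])
    then show ?thesis by simp
  qed
  then have "(\<lambda>N. (norm (trunc N \<psi> - \<psi>))\<^sup>2) \<longlonglongrightarrow> 0"
    using suminf_exist_split2[OF ell2_summable[of \<psi>]] by simp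
  then have "(\<lambda>N. sqrt ((norm (trunc N \<psi> - \<psi>))\<^sup>2)) \<longlonglongrightarrow> sqrt 0"
    by (rule tendsto_real_sqrt)
  then have "(\<lambda>N. norm (trunc N \<psi> - \<psi>)) \<longlonglongrightarrow> 0"
    by simp
  then show ?thesis
    by (rule LIM_zero_cancel[OF tendsto_norm_zero_cancel])
qed

lemma coord_tendsto_zero: "coord \<psi> \<longlonglongrightarrow> 0"
proof -
  have "(\<lambda>n. sqrt ((cmod (coord \<psi> n))\<^sup>2)) \<longlonglongrightarrow> sqrt 0"
    by (intro tendsto_real_sqrt summable_LIMSEQ_zero ell2_summable)
  then have "(\<lambda>n. cmod (coord \<psi> n)) \<longlonglongrightarrow> 0"
    by simp
  then show ?thesis
    by (rule tendsto_norm_zero_cancel)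
qed


text \<open>The equation \<open>B B' x = y\<close> is solved by iterating the contraction
  \<open>x \<mapsto> x + t (y - B B' x)\<close> for a small \<open>t > 0\<close>.\<close>

lemma surj_of_adjoint_bounded_below:
  fixes B B' :: "'a::{real_inner, banach} \<Rightarrow> 'a"
  assumes B: "bounded_linear B" and B': "bounded_linear B'"
    and adj: "\<And>x y. inner (B x) y = inner x (B' y)"
    and low: "\<And>x. \<gamma> * norm x \<le> norm (B' x)" and "\<gamma> > 0"
  shows "surj B"
proof -
  interpret B: bounded_linear B by (rule B)
  interpret B': bounded_linear B' by (rule B')
  obtain K where K: "K > 0" "\<And>x. norm (B x) \<le> norm x * K"
    using B.pos_bounded by blast
  \<comment> \<open>The first bound lets half of the linear gain absorb the quadratic term of the
    expanded norm, leaving the contraction factor \<open>q\<close>; the second keeps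
    \<open>q\<^sup>2\<close> at least 1/2.\<close>
  define t where "t = min (1 / K\<^sup>2) ((1/2) / \<gamma>\<^sup>2)"
  define q where "q = sqrt (1 - t * \<gamma>\<^sup>2)"
  have pos: "K\<^sup>2 > 0" "\<gamma>\<^sup>2 > 0"
    using K(1) \<open>\<gamma> > 0\<close> by simp_all
  have t0: "t > 0"
    unfolding t_def using pos by simp
  have tK: "t * K\<^sup>2 \<le> 1"
    using min.cobounded1[of "1 / K\<^sup>2" "(1/2) / \<gamma>\<^sup>2"] pos(1)
    unfolding t_def[symmetric] by (simp only: pos_le_divide_eq)
  have t\<gamma>: "t * \<gamma>\<^sup>2 \<le> 1/2"
    using min.cobounded2[of "1 / K\<^sup>2" "(1/2) / \<gamma>\<^sup>2"] pos(2)
    unfolding t_def[symmetric] by (simp only: pos_le_divide_eq)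
  have q2: "q\<^sup>2 = 1 - t * \<gamma>\<^sup>2"
    unfolding q_def using t\<gamma> by simp
  have q: "0 \<le> q" "q < 1"
    using t\<gamma> mult_pos_pos[OF t0 pos(2)] by (simp_all add: q_def)
  have contr: "norm (x - t *\<^sub>R B (B' x)) \<le> q * norm x" for x
  proof (rule power2_le_imp_le)
    define n where "n = (norm (B' x))\<^sup>2"
    have "(norm (B (B' x)))\<^sup>2 \<le> (norm (B' x) * K)\<^sup>2"
      by (intro power_mono K) auto
    then have "t\<^sup>2 * (norm (B (B' x)))\<^sup>2 \<le> t\<^sup>2 * (K\<^sup>2 * n)"
      by (intro mult_left_mono) (simp_all add: n_def power_mult_distrib mult.commute)
    also have "\<dots> = (t * K\<^sup>2) * (t * n)"
      by (simp add: power2_eq_square)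
    also have "\<dots> \<le> 1 * (t * n)"
      using t0 tK by (intro mult_right_mono) (auto simp: n_def)
    finally have 1: "t\<^sup>2 * (norm (B (B' x)))\<^sup>2 \<le> t * n" by simp
    have "(\<gamma> * norm x)\<^sup>2 \<le> n"
      unfolding n_def using \<open>\<gamma> > 0\<close> low[of x] by (intro power_mono) auto
    then have 2: "t * (\<gamma> * norm x)\<^sup>2 \<le> t * n"
      using t0 by (intro mult_left_mono) auto
    have "(norm (x - t *\<^sub>R B (B' x)))\<^sup>2
        = (norm x)\<^sup>2 - 2 * (t * inner (B (B' x)) x) + t\<^sup>2 * (norm (B (B' x)))\<^sup>2"
      using dot_norm_neg[of "t *\<^sub>R B (B' x)" x] t0
      by (simp add: norm_minus_commute power_mult_distrib)
    also have "inner (B (B' x)) x = n"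
      by (simp add: adj n_def dot_square_norm)
    finally have "(norm (x - t *\<^sub>R B (B' x)))\<^sup>2 \<le> (norm x)\<^sup>2 - t * (\<gamma> * norm x)\<^sup>2"
      using 1 2 by linarith
    also have "\<dots> = (q * norm x)\<^sup>2"
      by (simp only: power_mult_distrib q2) (simp add: left_diff_distrib)
    finally show "(norm (x - t *\<^sub>R B (B' x)))\<^sup>2 \<le> (q * norm x)\<^sup>2" .
  qed (use q in auto)
  show ?thesis
  proof (rule surjI)
    fix y
    define \<Phi> where "\<Phi> x = x + t *\<^sub>R (y - B (B' x))" for x
    have "dist (\<Phi> x) (\<Phi> x') \<le> q * dist x x'" for x x'
    proof -
      have "\<Phi> x - \<Phi> x' = (x - x') - t *\<^sub>R B (B' (x - x'))"
        by (simp add: \<Phi>_def B.diff B'.diff algebra_simps)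
      then show ?thesis using contr[of "x - x'"] by (simp add: dist_norm)
    qed
    then have "\<exists>!x. \<Phi> x = x"
      using banach_fix_type[OF q, of \<Phi>] by blast
    then obtain x where "\<Phi> x = x" by blast
    then have "B (B' x) = y" using t0 by (simp add: \<Phi>_def)
    then show "B (SOME x. B x = y) = y" by (rule someI)
  qed
qed


section \<open>Half-line Jacobi operators\<close>

lift_definition lshift :: "ell2 \<Rightarrow> ell2" is "\<lambda>\<psi> n. \<psi> (n + 1)"
  unfolding square_summable_def by (subst summable_iff_shift)

lift_definition rshift :: "nat \<Rightarrow> ell2 \<Rightarrow> ell2" is "\<lambda>m \<psi> n. if n < m then 0 else \<psi> (n - m)"
  subgoal for m \<psi>
    unfolding square_summable_def by (subst summable_iff_shift[symmetric, of _ m]) simp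
  done

definition diag :: "(nat \<Rightarrow> complex) \<Rightarrow> ell2 \<Rightarrow> ell2" where
  "diag c \<psi> = Abs_ell2 (\<lambda>n. c n * coord \<psi> n)"

definition jacobi :: "(nat \<Rightarrow> complex) \<Rightarrow> ell2 \<Rightarrow> ell2" where
  "jacobi c \<psi> = lshift \<psi> + rshift 1 \<psi> + diag c \<psi>"

lemma coord_lshift [simp]: "coord (lshift \<psi>) n = coord \<psi> (Suc n)"
  by (simp add: lshift.rep_eq)

lemma coord_rshift [simp]: "coord (rshift m \<psi>) n = (if n < m then 0 else coord \<psi> (n - m))"
  by (simp add: rshift.rep_eq)

lemma diag_bounded:
  assumes "\<And>n. cmod (c n) \<le> C"
  shows "coord (diag c \<psi>) n = c n * coord \<psi> n" and "norm (diag c \<psi>) \<le> C * norm \<psi>"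
  using square_summable_bounded_mult[OF square_summable_coord[of \<psi>] assms]
  by (simp_all add: diag_def coord_Abs_ell2 norm_ell2.rep_eq)

lemma coord_diag:
  assumes "bounded (range c)"
  shows "coord (diag c \<psi>) n = c n * coord \<psi> n"
proof -
  obtain C where "\<And>n. cmod (c n) \<le> C" using assms by (auto simp: bounded_iff)
  then show ?thesis by (rule diag_bounded(1))
qed

lemma coord_jacobi:
  assumes "bounded (range c)"
  shows "coord (jacobi c \<psi>) n =
    coord \<psi> (Suc n) + (if n = 0 then 0 else coord \<psi> (n - 1)) + c n * coord \<psi> n"
  by (simp add: jacobi_def coord_diag[OF assms])

lemma norm_rshift [simp]: "norm (rshift m \<psi>) = norm \<psi>"
proof -
  have "(norm (rshift m \<psi>))\<^sup>2 = (norm \<psi>)\<^sup>2"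
    unfolding norm_ell2_sq by (subst suminf_split_initial_segment[OF ell2_summable, of _ m]) simp
  then show ?thesis by simp
qed

lemma norm_lshift: "norm (lshift \<psi>) \<le> norm \<psi>"
proof (rule power2_le_imp_le)
  show "(norm (lshift \<psi>))\<^sup>2 \<le> (norm \<psi>)\<^sup>2"
    unfolding norm_ell2_sq
    by (subst (2) suminf_split_initial_segment[OF ell2_summable, of _ 1]) simp
qed simp

lemma norm_jacobi_le:
  assumes "\<And>n. cmod (c n) \<le> C"
  shows "norm (jacobi c \<psi>) \<le> (2 + C) * norm \<psi>"
proof -
  have "norm (jacobi c \<psi>) \<le> norm (lshift \<psi>) + norm (rshift 1 \<psi>) + norm (diag c \<psi>)"
    unfolding jacobi_def by (intro order.trans[OF norm_triangle_ineq] add_right_mono norm_triangle_ineq)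
  also have "\<dots> \<le> norm \<psi> + norm \<psi> + C * norm \<psi>"
    by (intro add_mono norm_lshift diag_bounded(2) assms) simp
  finally show ?thesis by (simp add: algebra_simps)
qed

lemma jacobi_linear:
  assumes "bounded (range c)"
  shows jacobi_add: "jacobi c (\<phi> + \<psi>) = jacobi c \<phi> + jacobi c \<psi>"
    and jacobi_diff: "jacobi c (\<phi> - \<psi>) = jacobi c \<phi> - jacobi c \<psi>"
    and jacobi_cscale: "jacobi c (a *\<^sub>\<complex> \<psi>) = a *\<^sub>\<complex> jacobi c \<psi>"
  by (rule ell2_eqI; simp add: coord_jacobi[OF assms] algebra_simps)+

lemma bounded_linear_jacobi:
  assumes "bounded (range c)"
  shows "bounded_linear (jacobi c)"
proof -
  obtain C where "\<And>n. cmod (c n) \<le> C" using assms by (auto simp: bounded_iff)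
  note C = norm_jacobi_le[OF this]
  show ?thesis
    using C by (intro bounded_linear_intro[of _ "2 + C"])
      (simp_all add: jacobi_add[OF assms] jacobi_cscale[OF assms] scaleR_ell2_def mult.commute)
qed

lemma bounded_clinear_jacobi: "bounded (range c) \<Longrightarrow> bounded_clinear_ell2 (jacobi c)"
  by (simp add: bounded_clinear_ell2_def bounded_linear_jacobi jacobi_cscale)

lemma jacobi_add_diag:
  assumes "bounded (range c)"
  shows "jacobi (c(0 := c 0 + \<kappa>)) \<psi> = jacobi c \<psi> + (\<kappa> * coord \<psi> 0) *\<^sub>\<complex> unit_ell2"
proof -
  have "bounded (range (c(0 := c 0 + \<kappa>)))"
    by (rule bounded_subset[of "insert (c 0 + \<kappa>) (range c)"]) (use assms in auto)
  then show ?thesis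
    by (intro ell2_eqI) (simp add: coord_jacobi assms algebra_simps)
qed

section \<open>Adjoints, quadratic forms and a Fredholm criterion\<close>

lemma inner_lshift: "inner (lshift \<phi>) \<psi> = inner \<phi> (rshift 1 \<psi>)"
proof -
  define f where "f n = Re (coord \<phi> n * cnj (coord (rshift 1 \<psi>) n))" for n
  have "f sums (inner \<phi> (rshift 1 \<psi>) + f 0)"
    using inner_ell2_sums[of \<phi> "rshift 1 \<psi>"] unfolding f_def[symmetric] by (simp add: f_def[of 0])
  then have "(\<lambda>n. f (Suc n)) sums inner \<phi> (rshift 1 \<psi>)"
    by (simp only: sums_Suc_iff)
  then show ?thesis
    using sums_unique2[OF inner_ell2_sums[of "lshift \<phi>" \<psi>]] by (simp add: f_def)
qed

lemma bounded_range_cnj: "bounded (range c) \<Longrightarrow> bounded (range (\<lambda>n. cnj (c n)))"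
  by (simp add: bounded_iff)

lemma inner_jacobi:
  assumes "bounded (range c)"
  shows "inner (jacobi c \<phi>) \<psi> = inner \<phi> (jacobi (\<lambda>n. cnj (c n)) \<psi>)"
proof -
  note c = bounded_range_cnj[OF assms]
  have "inner (diag c \<phi>) \<psi> = inner \<phi> (diag (\<lambda>n. cnj (c n)) \<psi>)"
    by (simp add: inner_ell2_def coord_diag assms c algebra_simps)
  moreover have "inner (rshift 1 \<phi>) \<psi> = inner \<phi> (lshift \<psi>)"
    by (metis inner_commute inner_lshift)
  ultimately show ?thesis
    by (simp only: jacobi_def inner_add_left inner_add_right inner_lshift)
qed

lemma inner_imaginary_unit: "inner \<phi> (\<i> *\<^sub>\<complex> \<psi>) = - inner (\<i> *\<^sub>\<complex> \<phi>) \<psi>"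
  by (rule sums_unique2[OF inner_ell2_sums])
     (use sums_minus[OF inner_ell2_sums[of "\<i> *\<^sub>\<complex> \<phi>" \<psi>]] in \<open>simp add: algebra_simps\<close>)

text \<open>The right-hand side is the imaginary part of the quadratic form. The two shifts are
  adjoint to each other, so only the diagonal contributes.\<close>

lemma jacobi_Im_sums:
  assumes "bounded (range c)"
  shows "(\<lambda>n. Im (c n) * (cmod (coord \<psi> n))\<^sup>2) sums inner (jacobi c \<psi>) (\<i> *\<^sub>\<complex> \<psi>)"
proof -
  have i: "rshift 1 (\<i> *\<^sub>\<complex> \<psi>) = \<i> *\<^sub>\<complex> rshift 1 \<psi>"
    by (rule ell2_eqI) simp
  have "inner (lshift \<psi>) (\<i> *\<^sub>\<complex> \<psi>) + inner (rshift 1 \<psi>) (\<i> *\<^sub>\<complex> \<psi>) = 0"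
    unfolding inner_lshift i inner_imaginary_unit[of \<psi>] by (simp add: inner_commute)
  then have "inner (jacobi c \<psi>) (\<i> *\<^sub>\<complex> \<psi>) = inner (diag c \<psi>) (\<i> *\<^sub>\<complex> \<psi>)"
    by (simp add: jacobi_def inner_add_left)
  moreover have "Re (coord (diag c \<psi>) n * cnj (coord (\<i> *\<^sub>\<complex> \<psi>) n)) = Im (c n) * (cmod (coord \<psi> n))\<^sup>2" for n
    unfolding cmod_power2 by (simp add: coord_diag[OF assms] power2_eq_square algebra_simps)
  ultimately show ?thesis
    using inner_ell2_sums[of "diag c \<psi>" "\<i> *\<^sub>\<complex> \<psi>"] by simp
qed

text \<open>With \<open>B = A + \<kappa> \<langle>\<delta>\<^sub>0, \<cdot>\<rangle> \<delta>\<^sub>0\<close> invertible, everything about \<open>A\<close> can be read off from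
  the number \<open>1 - \<kappa> \<langle>\<delta>\<^sub>0, B\<^sup>-\<^sup>1 \<delta>\<^sub>0\<rangle>\<close>.\<close>

lemma fredholm_jacobi:
  assumes c: "bounded (range c)" and "\<gamma> > 0"
    and low: "\<And>\<psi>. \<gamma> * norm \<psi> \<le> norm (jacobi (c(0 := c 0 + \<kappa>)) \<psi>)"
    and low_adj: "\<And>\<psi>. \<gamma> * norm \<psi> \<le> norm (jacobi (\<lambda>n. cnj ((c(0 := c 0 + \<kappa>)) n)) \<psi>)"
  shows "fredholm (jacobi c)"
proof -
  define A where "A = jacobi c"
  define B where "B = jacobi (c(0 := c 0 + \<kappa>))"
  have c': "bounded (range (c(0 := c 0 + \<kappa>)))"
    by (rule bounded_subset[of "insert (c 0 + \<kappa>) (range c)"]) (use c in auto)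
  note c'' = bounded_range_cnj[OF c']
  interpret B: bounded_linear B
    unfolding B_def by (rule bounded_linear_jacobi[OF c'])
  have BA: "B \<psi> = A \<psi> + (\<kappa> * coord \<psi> 0) *\<^sub>\<complex> unit_ell2" for \<psi>
    unfolding A_def B_def by (rule jacobi_add_diag[OF c])
  have "surj B"
    unfolding B_def
    by (rule surj_of_adjoint_bounded_below[OF bounded_linear_jacobi[OF c'] bounded_linear_jacobi[OF c'']
          inner_jacobi[OF c'] low_adj \<open>\<gamma> > 0\<close>])
  then obtain R where BR: "\<And>\<psi>. B (R \<psi>) = \<psi>"
    by (metis surjD)
  have inj: "\<phi> = \<psi>" if "B \<phi> = B \<psi>" for \<phi> \<psi>
    using low[of "\<phi> - \<psi>"] that \<open>\<gamma> > 0\<close> unfolding B_def[symmetric] B.diff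
    by (simp add: mult_le_0_iff)
  define g where "g = R unit_ell2"
  have Bscale: "B (a *\<^sub>\<complex> \<psi>) = a *\<^sub>\<complex> B \<psi>" for a \<psi>
    unfolding B_def by (rule jacobi_cscale[OF c'])
  \<comment> \<open>\<open>A \<phi> = \<psi>\<close> fixes \<phi> up to the scalar
    \<open>coord \<phi> 0\<close>, for which coordinate 0 leaves a single linear equation.\<close>
  have A_iff: "A \<phi> = \<psi> \<longleftrightarrow> \<phi> = R \<psi> + (\<kappa> * coord \<phi> 0) *\<^sub>\<complex> g" for \<phi> \<psi>
  proof -
    have "A \<phi> = \<psi> \<longleftrightarrow> B \<phi> = B (R \<psi> + (\<kappa> * coord \<phi> 0) *\<^sub>\<complex> g)"
      by (simp add: BA[of \<phi>] B.add Bscale BR g_def)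
    then show ?thesis using inj by metis
  qed
  have "{\<psi>. A \<psi> = 0} \<subseteq> ell2.span {g}"
  proof
    fix \<psi> assume "\<psi> \<in> {\<psi>. A \<psi> = 0}"
    moreover have "R 0 = 0" by (rule inj) (simp add: BR)
    ultimately have "\<psi> = (\<kappa> * coord \<psi> 0) *\<^sub>\<complex> g"
      using A_iff[of \<psi> 0] by simp
    then show "\<psi> \<in> ell2.span {g}"
      by (metis ell2.span_base ell2.span_scale singletonI)
  qed
  moreover have "closed (range A)"
  proof (cases "1 - \<kappa> * coord g 0 = 0")
    case False
    have "\<exists>\<phi>. A \<phi> = \<psi>" for \<psi>
    proof
      \<comment> \<open>\<open>a\<close> stands for \<open>\<kappa> * coord \<phi> 0\<close>; this
        value solves the consistency equation at coordinate 0.\<close>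
      define a where "a = \<kappa> * coord (R \<psi>) 0 / (1 - \<kappa> * coord g 0)"
      have "\<kappa> * coord (R \<psi> + a *\<^sub>\<complex> g) 0 = a"
        using False by (simp add: a_def divide_simps) (simp add: algebra_simps)
      then show "A (R \<psi> + a *\<^sub>\<complex> g) = \<psi>"
        by (simp only: A_iff)
    qed
    then have "range A = UNIV" by (metis surjI someI_ex surj_def)
    then show ?thesis by simp
  next
    case True
    have "range A = {\<psi>. \<kappa> * coord (R \<psi>) 0 = 0}"
    proof (intro set_eqI iffI CollectI)
      fix \<psi> assume "\<psi> \<in> range A"
      then obtain \<phi> where "A \<phi> = \<psi>" by auto
      then have "coord \<phi> 0 = coord (R \<psi> + (\<kappa> * coord \<phi> 0) *\<^sub>\<complex> g) 0"
        using A_iff by metis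
      then have "coord \<phi> 0 * (1 - \<kappa> * coord g 0) = coord (R \<psi>) 0"
        by (simp add: algebra_simps)
      then show "\<kappa> * coord (R \<psi>) 0 = 0" using True by simp
    next
      fix \<psi> assume "\<psi> \<in> {\<psi>. \<kappa> * coord (R \<psi>) 0 = 0}"
      then have "A (R \<psi>) = \<psi>" unfolding A_iff by simp
      then show "\<psi> \<in> range A" by (metis rangeI)
    qed
    \<comment> \<open>\<open>R\<close> was obtained as a mere choice of preimages; the lower bound
      for \<open>B\<close> makes it Lipschitz.\<close>
    moreover have "continuous_on UNIV (\<lambda>\<psi>. \<kappa> * coord (R \<psi>) 0)"
    proof -
      have "norm (R \<phi> - R \<psi>) \<le> 1 / \<gamma> * norm (\<phi> - \<psi>)" for \<phi> \<psi>
        using low[of "R \<phi> - R \<psi>"] \<open>\<gamma> > 0\<close> unfolding B_def[symmetric] B.diff BR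
        by (simp add: field_simps)
      then have "continuous_on UNIV R"
        using \<open>\<gamma> > 0\<close>
        by (intro lipschitz_on_continuous_on[of "1 / \<gamma>"] lipschitz_onI) (auto simp: dist_norm)
      then show ?thesis
        by (intro continuous_intros bounded_linear.continuous_on[OF bounded_linear_coord])
    qed
    ultimately show ?thesis
      using continuous_closed_vimage[of "{0}" "\<lambda>\<psi>. \<kappa> * coord (R \<psi>) 0"]
      by (simp add: vimage_def continuous_on_eq_continuous_within)
  qed
  moreover have "\<psi> - A (R \<psi>) \<in> ell2.span {unit_ell2}" for \<psi>
  proof -
    have "\<psi> - A (R \<psi>) = (\<kappa> * coord (R \<psi>) 0) *\<^sub>\<complex> unit_ell2"
      using BA[of "R \<psi>"] by (simp add: BR algebra_simps)
    then show ?thesis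
      by (simp add: ell2.span_base ell2.span_scale)
  qed
  ultimately show ?thesis
    unfolding fredholm_def A_def[symmetric]
    using bounded_clinear_jacobi[OF c] unfolding A_def[symmetric]
    by (meson finite.emptyI finite_insert)
qed

lemma jacobi_nonreal_bounded_below:
  assumes "bounded (range c)" and "\<And>n. Im (c n) = s"
  shows "\<bar>s\<bar> * norm \<psi> \<le> norm (jacobi c \<psi>)"
proof (cases "\<psi> = 0")
  case False
  have "(\<lambda>n. s * (cmod (coord \<psi> n))\<^sup>2) sums (s * (norm \<psi>)\<^sup>2)"
    unfolding norm_ell2_sq by (intro sums_mult summable_sums ell2_summable)
  from sums_unique2[OF this jacobi_Im_sums[OF assms(1), of \<psi>, unfolded assms(2)]]
  have "\<bar>s\<bar> * (norm \<psi>)\<^sup>2 \<le> norm (jacobi c \<psi>) * norm \<psi>"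
    using Cauchy_Schwarz_ineq2[of "jacobi c \<psi>" "\<i> *\<^sub>\<complex> \<psi>"]
    by (simp add: norm_cscale flip: abs_mult)
  then show ?thesis
    using False by (simp add: power2_eq_square)
qed simp

text \<open>The imaginary part of \<open>\<langle>B \<psi>, \<psi>\<rangle>\<close> controls \<open>\<psi>(0)\<close>, and the assumption controls the rest.\<close>

lemma jacobi_rank_one_bounded_below:
  assumes c: "\<And>n. cmod (c n) \<le> M" and real: "\<And>n. Im (c n) = 0"
    and "\<epsilon> > 0" and low: "\<And>\<psi>. coord \<psi> 0 = 0 \<Longrightarrow> \<epsilon> * norm \<psi> \<le> norm (jacobi c \<psi>)"
    and s: "s = 1 \<or> s = - 1"
  shows "\<epsilon>\<^sup>2 / (2 * \<epsilon> + (3 + M + \<epsilon>)\<^sup>2) * norm \<psi> \<le> norm (jacobi (c(0 := c 0 + complex_of_real s * \<i>)) \<psi>)"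
proof (cases "\<psi> = 0")
  case False
  define c' where "c' = c(0 := c 0 + complex_of_real s * \<i>)"
  define N p \<beta> K where "N = norm \<psi>" and "p = cmod (coord \<psi> 0)" and "\<beta> = norm (jacobi c' \<psi>)"
    and "K = 3 + M + \<epsilon>"
  have cb: "bounded (range c)" using c by (auto simp: bounded_iff)
  have M: "0 \<le> M" using norm_ge_zero[of "c 0"] c[of 0] by linarith
  have c'M: "cmod (c' n) \<le> M + 1" for n
  proof -
    have "cmod (c' 0) \<le> cmod (c 0) + cmod (complex_of_real s * \<i>)"
      unfolding c'_def fun_upd_same by (rule norm_triangle_ineq)
    then have "cmod (c' 0) \<le> M + 1" using c[of 0] s by (auto simp: norm_mult)
    moreover have "cmod (c' n) \<le> M + 1" if "n \<noteq> 0" using that c[of n] by (simp add: c'_def)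
    ultimately show ?thesis by (cases "n = 0") auto
  qed
  then have c'b: "bounded (range c')" by (auto simp: bounded_iff)
  have N: "N > 0" using False by (simp add: N_def)
  have p: "p\<^sup>2 \<le> \<beta> * N"
  proof -
    have "(\<lambda>n. Im (c' n) * (cmod (coord \<psi> n))\<^sup>2) sums (\<Sum>n\<in>{0}. Im (c' n) * (cmod (coord \<psi> n))\<^sup>2)"
      by (rule sums_finite) (auto simp: c'_def real)
    from sums_unique2[OF this jacobi_Im_sums[OF c'b, of \<psi>]]
    have "s * p\<^sup>2 = inner (jacobi c' \<psi>) (\<i> *\<^sub>\<complex> \<psi>)"
      by (simp add: c'_def real p_def)
    then have "\<bar>s * p\<^sup>2\<bar> \<le> \<beta> * N"
      using Cauchy_Schwarz_ineq2[of "jacobi c' \<psi>" "\<i> *\<^sub>\<complex> \<psi>"] by (simp add: norm_cscale \<beta>_def N_def)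
    then show ?thesis using s by auto
  qed
  \<comment> \<open>Once the entry at 0 is removed, the two operators agree and the hypothesis
    applies. The removed part costs its length \<open>p\<close> times the operator bound
    \<open>2 + (M + 1)\<close>.\<close>
  have "\<epsilon> * (N - p) \<le> \<beta> + (3 + M) * p"
  proof -
    define \<phi> where "\<phi> = coord \<psi> 0 *\<^sub>\<complex> unit_ell2"
    have \<phi>: "norm \<phi> = p" by (simp add: \<phi>_def norm_cscale p_def)
    have "N - p \<le> norm (\<psi> - \<phi>)"
      using norm_triangle_ineq2[of \<psi> \<phi>] by (simp add: N_def \<phi>)
    then have "\<epsilon> * (N - p) \<le> \<epsilon> * norm (\<psi> - \<phi>)"
      using \<open>\<epsilon> > 0\<close> by simp
    also have "\<dots> \<le> norm (jacobi c (\<psi> - \<phi>))"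
      by (rule low) (simp add: \<phi>_def)
    also have "jacobi c (\<psi> - \<phi>) = jacobi c' (\<psi> - \<phi>)"
      unfolding c'_def jacobi_add_diag[OF cb] by (simp add: \<phi>_def)
    also have "\<dots> = jacobi c' \<psi> - jacobi c' \<phi>" by (rule jacobi_diff[OF c'b])
    also have "norm \<dots> \<le> \<beta> + norm (jacobi c' \<phi>)"
      unfolding \<beta>_def by (rule norm_triangle_ineq4)
    also have "norm (jacobi c' \<phi>) \<le> (2 + (M + 1)) * p"
      using norm_jacobi_le[OF c'M, where \<psi> = \<phi>] by (simp add: \<phi>)
    finally show ?thesis by (simp add: algebra_simps)
  qed
  then have 1: "\<epsilon> * N \<le> \<beta> + K * p" by (simp add: K_def algebra_simps)
  \<comment> \<open>The arithmetic-geometric mean inequality balances \<open>K * p\<close> against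
    \<open>\<epsilon> * N\<close>; with \<open>p\<^sup>2 \<le> \<beta> * N\<close> one factor
    \<open>N\<close> cancels and a linear bound remains. The constant of the statement comes from
    here.\<close>
  have Kp: "2 * \<epsilon> * (K * p) \<le> \<epsilon>\<^sup>2 * N + K\<^sup>2 * \<beta>"
  proof -
    have "N * (2 * \<epsilon> * (K * p)) \<le> (\<epsilon> * N)\<^sup>2 + (K * p)\<^sup>2"
      using sum_squares_bound[of "\<epsilon> * N" "K * p"] by (simp add: algebra_simps)
    also have "(K * p)\<^sup>2 \<le> K\<^sup>2 * (\<beta> * N)"
      using p by (simp add: power_mult_distrib mult_left_mono)
    finally have "N * (2 * \<epsilon> * (K * p)) \<le> N * (\<epsilon>\<^sup>2 * N + K\<^sup>2 * \<beta>)"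
      by (simp add: power2_eq_square algebra_simps)
    then show ?thesis using N by simp
  qed
  have "2 * \<epsilon> * (\<epsilon> * N) \<le> 2 * \<epsilon> * (\<beta> + K * p)"
    using 1 \<open>\<epsilon> > 0\<close> by (intro mult_left_mono) auto
  then have "\<epsilon>\<^sup>2 * N \<le> (2 * \<epsilon> + K\<^sup>2) * \<beta>"
    using Kp by (simp add: power2_eq_square algebra_simps)
  moreover have "2 * \<epsilon> + K\<^sup>2 > 0" using \<open>\<epsilon> > 0\<close> by (simp add: add_pos_nonneg)
  ultimately have "\<epsilon>\<^sup>2 / (2 * \<epsilon> + K\<^sup>2) * N \<le> \<beta>" by (simp add: field_simps)
  then show ?thesis by (simp add: N_def \<beta>_def K_def c'_def)
qed simp

lemma jacobi_bounded_below_extend: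
  assumes c: "bounded (range c)"
    and low: "\<And>\<psi> L. coord \<psi> 0 = 0 \<Longrightarrow> (\<And>n. n > L \<Longrightarrow> coord \<psi> n = 0) \<Longrightarrow> \<epsilon> * norm \<psi> \<le> norm (jacobi c \<psi>)"
    and "coord \<psi> 0 = 0"
  shows "\<epsilon> * norm \<psi> \<le> norm (jacobi c \<psi>)"
proof (rule LIMSEQ_le)
  show "(\<lambda>N. \<epsilon> * norm (trunc N \<psi>)) \<longlonglongrightarrow> \<epsilon> * norm \<psi>"
    by (intro tendsto_intros trunc_tendsto)
  show "(\<lambda>N. norm (jacobi c (trunc N \<psi>))) \<longlonglongrightarrow> norm (jacobi c \<psi>)"
    by (intro tendsto_norm bounded_linear.tendsto[OF bounded_linear_jacobi[OF c]] trunc_tendsto)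
  show "\<exists>N. \<forall>n\<ge>N. \<epsilon> * norm (trunc n \<psi>) \<le> norm (jacobi c (trunc n \<psi>))"
  proof (intro exI allI impI)
    fix n show "\<epsilon> * norm (trunc n \<psi>) \<le> norm (jacobi c (trunc n \<psi>))"
      by (rule low[of _ n]) (use assms(3) in auto)
  qed
qed

lemma schroedinger_minus_eq_jacobi:
  assumes "bounded (range V)"
  shows "schroedinger V \<psi> - z *\<^sub>\<complex> \<psi> = jacobi (\<lambda>n. complex_of_real (V n) - z) \<psi>"
proof -
  have "bounded (range (\<lambda>n. complex_of_real (V n) - z))"
    using bounded_translation_minus[OF bounded_linear_image[OF assms bounded_linear_of_real], of z]
    by (simp add: image_image)
  then show ?thesis
    by (intro ell2_eqI)
      (simp add: coord_schroedinger[OF assms] schroedinger_seq_def coord_jacobi algebra_simps)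
qed

lemma essential_spectrum_real:
  assumes "bounded (range V)" and "z \<in> essential_spectrum (schroedinger V)"
  shows "Im z = 0"
proof (rule ccontr)
  assume z: "Im z \<noteq> 0"
  define c where "c n = complex_of_real (V n) - z" for n
  have b: "bounded (range c)"
    using bounded_translation_minus[OF bounded_linear_image[OF assms(1) bounded_linear_of_real], of z]
    by (simp add: c_def image_image)
  note b' = bounded_range_cnj[OF b]
  \<comment> \<open>The Fredholm criterion is used with \<kappa> = 0: off the real axis the operator
    and its adjoint are already bounded below.\<close>
  have c0: "c(0 := c 0 + 0) = c" by simp
  have "fredholm (jacobi c)"
  proof (rule fredholm_jacobi[of c "\<bar>Im z\<bar>" 0], unfold c0)
    show "\<bar>Im z\<bar> * norm \<psi> \<le> norm (jacobi c \<psi>)" for \<psi>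
      using jacobi_nonreal_bounded_below[OF b, of "- Im z" \<psi>] by (simp add: c_def)
    show "\<bar>Im z\<bar> * norm \<psi> \<le> norm (jacobi (\<lambda>n. cnj (c n)) \<psi>)" for \<psi>
      by (rule jacobi_nonreal_bounded_below[OF b']) (simp add: c_def)
  qed (use b z in auto)
  then show False
    using assms by (simp add: essential_spectrum_def schroedinger_minus_eq_jacobi c_def[abs_def])
qed


section \<open>Essential spectrum along dense orbits\<close>

lemma norm_trunc_le: "norm (trunc N \<psi>) \<le> norm \<psi>"
proof (rule power2_le_imp_le)
  show "(norm (trunc N \<psi>))\<^sup>2 \<le> (norm \<psi>)\<^sup>2"
    unfolding norm_ell2_sq by (intro suminf_le ell2_summable) auto
qed simp

text \<open>In the space of sequences vanishing at \<open>0\<close> the equation \<open>A \<eta> = \<Sum>k. d k A \<psi>\<^sub>k\<close> has at most the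
  formal solution \<open>\<Sum>k. d k \<psi>\<^sub>k\<close>, which is square-summable only if \<open>d\<close> tends to \<open>0\<close>.\<close>

lemma jacobi_block_coefficients_tendsto_zero:
  assumes c: "bounded (range c)"
    and s: "strict_mono s"
    and supp: "\<And>k n. coord (\<psi> k) n \<noteq> 0 \<Longrightarrow> s k < n \<and> n < s (Suc k)"
    and norm: "\<And>k. norm (\<psi> k) = 1"
    and "coord \<eta> 0 = 0"
    and sums: "(\<lambda>k. d k *\<^sub>\<complex> jacobi c (\<psi> k)) sums jacobi c \<eta>"
  shows "d \<longlonglongrightarrow> 0"
proof -
  have s_le: "s i \<le> s j" if "i \<le> j" for i j
    using strict_mono_less_eq[OF s] that by simp
  \<comment> \<open>Row m of the equation determines entry m + 1 from earlier entries, and the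
    blocks from \<open>K\<close> on vanish up to \<open>s K\<close>, so they do not enter these
    rows.\<close>
  have agree: "coord \<eta> n = (\<Sum>k<K. d k * coord (\<psi> k) n)" if "n \<le> s K" for n K
    using that
  proof (induction n rule: less_induct)
    case (less n)
    show ?case
    proof (cases n)
      case 0
      then show ?thesis using supp[of _ 0] \<open>coord \<eta> 0 = 0\<close> by fastforce
    next
      case (Suc m)
      have zero: "coord (jacobi c (\<psi> k)) m = 0" if "k \<ge> K" for k
      proof -
        have "coord (\<psi> k) j = 0" if "j \<le> Suc m" for j
          using supp[of k j] s_le[OF \<open>k \<ge> K\<close>] that less.prems Suc by fastforce
        then show ?thesis by (simp add: coord_jacobi[OF c])
      qed
      have "(\<lambda>k. d k * coord (jacobi c (\<psi> k)) m) sums (\<Sum>k<K. d k * coord (jacobi c (\<psi> k)) m)"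
        by (rule sums_finite) (auto simp: zero)
      from sums_unique2[OF ell2_sums_coord[OF sums, of m] this[folded coord_simps(5)]]
      have "coord (jacobi c \<eta>) m = (\<Sum>k<K. d k * coord (jacobi c (\<psi> k)) m)"
        by simp
      moreover have "coord \<eta> m = (\<Sum>k<K. d k * coord (\<psi> k) m)"
        by (rule less.IH) (use Suc less.prems in auto)
      moreover have "(if m = 0 then 0 else coord \<eta> (m - 1))
          = (\<Sum>k<K. d k * (if m = 0 then 0 else coord (\<psi> k) (m - 1)))"
        using less.IH[of "m - 1"] Suc less.prems by auto
      ultimately show ?thesis
        by (simp add: coord_jacobi[OF c] Suc algebra_simps sum.distrib sum_distrib_left)
    qed
  qed
  \<comment> \<open>Each scaled block is a window of \<eta>, so its norm is at most a tail norm of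
    \<eta>.\<close>
  have block: "d k *\<^sub>\<complex> \<psi> k = trunc (s (Suc k)) (\<eta> - trunc (Suc (s k)) \<eta>)" for k
  proof (rule ell2_eqI)
    fix n
    show "coord (d k *\<^sub>\<complex> \<psi> k) n = coord (trunc (s (Suc k)) (\<eta> - trunc (Suc (s k)) \<eta>)) n"
    proof (cases "s k < n \<and> n < s (Suc k)")
      case True
      have "coord (\<psi> j) n = 0" if "j < k" for j
        using supp[of j n] s_le[of "Suc j" k] that True by fastforce
      then show ?thesis
        using agree[of n "Suc k"] True by simp
    next
      case False
      then show ?thesis using supp[of k n] by auto
    qed
  qed
  have bound: "norm (d k) \<le> norm (\<eta> - trunc (Suc (s k)) \<eta>)" for k
    using norm_trunc_le[of "s (Suc k)" "\<eta> - trunc (Suc (s k)) \<eta>"]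
    unfolding block[symmetric] by (simp add: norm_cscale norm)
  have "(\<lambda>k. norm (\<eta> - trunc (Suc (s k)) \<eta>)) \<longlonglongrightarrow> norm (\<eta> - \<eta>)"
    using LIMSEQ_subseq_LIMSEQ[OF trunc_tendsto[of \<eta>], of "\<lambda>k. Suc (s k)"] s
    by (intro tendsto_intros) (auto simp: strict_mono_def o_def)
  then have "(\<lambda>k. norm (\<eta> - trunc (Suc (s k)) \<eta>)) \<longlonglongrightarrow> 0"
    by simp
  then show ?thesis
    by (rule Lim_null_comparison[OF always_eventually[OF allI[OF bound]]])
qed

text \<open>If the range were closed, it would contain \<open>\<Sum>k. d k A \<psi>\<^sub>k\<close> for the indicators \<open>d\<close> of the even
  and of the odd numbers. A linear combination of the two preimages vanishes at \<open>0\<close>.\<close>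

lemma not_fredholm_jacobi:
  assumes c: "bounded (range c)"
    and weyl: "\<And>N \<epsilon>. \<epsilon> > 0 \<Longrightarrow> \<exists>\<psi> L. (\<forall>n\<le>N. coord \<psi> n = 0) \<and> (\<forall>n>L. coord \<psi> n = 0) \<and>
      norm \<psi> = 1 \<and> norm (jacobi c \<psi>) < \<epsilon>"
  shows "\<not> fredholm (jacobi c)"
proof
  assume "fredholm (jacobi c)"
  then have closed: "closed (range (jacobi c))" by (simp add: fredholm_def)
  define P where "P N \<epsilon> p \<longleftrightarrow> (\<forall>n\<le>N. coord (fst p) n = 0) \<and> (\<forall>n>snd p. coord (fst p) n = 0) \<and>
      norm (fst p) = 1 \<and> norm (jacobi c (fst p)) < \<epsilon>" for N :: nat and \<epsilon> :: real and p :: "ell2 \<times> nat"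
  define \<Psi> l where "\<Psi> N \<epsilon> = fst (SOME p. P N \<epsilon> p)" and "l N \<epsilon> = snd (SOME p. P N \<epsilon> p)" for N \<epsilon>
  have P: "P N \<epsilon> (\<Psi> N \<epsilon>, l N \<epsilon>)" if "\<epsilon> > 0" for N \<epsilon>
  proof -
    have "\<exists>p. P N \<epsilon> p" using weyl[OF that] by (simp add: P_def)
    then have "P N \<epsilon> (SOME p. P N \<epsilon> p)" by (rule someI_ex)
    then show ?thesis by (simp add: \<Psi>_def l_def)
  qed
  have \<Psi>: "coord (\<Psi> N \<epsilon>) n = 0" if "\<epsilon> > 0" "n \<le> N \<or> n > l N \<epsilon>" for N \<epsilon> n
    using P[OF that(1)] that(2) by (auto simp: P_def)
  \<comment> \<open>Each block starts beyond the end of the previous one, and the errors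
    \<open>(1/2) ^ k\<close> are summable.\<close>
  define s where "s = rec_nat 0 (\<lambda>k N. Suc (max N (l N ((1/2) ^ k))))"
  define \<psi> where "\<psi> k = \<Psi> (s k) ((1/2) ^ k)" for k
  have s_Suc: "s (Suc k) = Suc (max (s k) (l (s k) ((1/2) ^ k)))" for k
    by (simp add: s_def)
  have s: "strict_mono s"
    by (simp add: strict_mono_Suc_iff s_Suc le_imp_less_Suc)
  have supp: "s k < n \<and> n < s (Suc k)" if "coord (\<psi> k) n \<noteq> 0" for k n
  proof -
    have "\<not> (n \<le> s k \<or> n > l (s k) ((1/2) ^ k))"
      using \<Psi>[of "(1/2) ^ k" n "s k"] that by (auto simp: \<psi>_def)
    then show ?thesis by (auto simp: s_Suc)
  qed
  have norm: "norm (\<psi> k) = 1" "norm (jacobi c (\<psi> k)) < (1/2) ^ k" for k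
    using P[of "(1/2) ^ k" "s k"] by (simp_all add: \<psi>_def P_def)
  have null: "d \<longlonglongrightarrow> 0"
    if "coord \<eta> 0 = 0" "(\<lambda>k. d k *\<^sub>\<complex> jacobi c (\<psi> k)) sums jacobi c \<eta>" for d \<eta>
    using supp by (rule jacobi_block_coefficients_tendsto_zero[OF c s _ norm(1) that])
  have preimage: "\<exists>\<phi>. (\<lambda>k. d k *\<^sub>\<complex> jacobi c (\<psi> k)) sums jacobi c \<phi>"
    if d: "\<And>k. cmod (d k) \<le> 1" for d
  proof -
    have "summable (\<lambda>k. d k *\<^sub>\<complex> jacobi c (\<psi> k))"
    proof (rule summable_comparison_test')
      show "summable (\<lambda>k. (1/2::real) ^ k)" by (simp add: summable_geometric)
      show "norm (d k *\<^sub>\<complex> jacobi c (\<psi> k)) \<le> (1/2) ^ k" for k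
        using mult_mono[OF d less_imp_le[OF norm(2)], of k k] by (simp add: norm_cscale)
    qed
    then obtain y where y: "(\<lambda>k. d k *\<^sub>\<complex> jacobi c (\<psi> k)) sums y"
      by (auto simp: summable_def)
    have "(\<Sum>k<K. d k *\<^sub>\<complex> jacobi c (\<psi> k)) \<in> range (jacobi c)" for K
    proof
      show "(\<Sum>k<K. d k *\<^sub>\<complex> jacobi c (\<psi> k)) = jacobi c (\<Sum>k<K. d k *\<^sub>\<complex> \<psi> k)"
        by (simp add: jacobi_cscale[OF c]
            linear_sum[OF bounded_linear.linear[OF bounded_linear_jacobi[OF c]]])
    qed simp
    then have "y \<in> range (jacobi c)"
      using y closed unfolding sums_def by (metis closed_sequentially)
    then show ?thesis using y by blast
  qed
  define ev od :: "nat \<Rightarrow> complex" where "ev k = (if even k then 1 else 0)" and "od k = (if odd k then 1 else 0)" for k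
  have "cmod (ev k) \<le> 1" "cmod (od k) \<le> 1" for k by (simp_all add: ev_def od_def)
  note preimage = preimage[of ev, OF this(1)] preimage[of od, OF this(2)]
  obtain \<phi>1 where \<phi>1: "(\<lambda>k. ev k *\<^sub>\<complex> jacobi c (\<psi> k)) sums jacobi c \<phi>1"
    using preimage(1) by blast
  obtain \<phi>2 where \<phi>2: "(\<lambda>k. od k *\<^sub>\<complex> jacobi c (\<psi> k)) sums jacobi c \<phi>2"
    using preimage(2) by blast
  have bl: "bounded_linear (cscale a)" for a
    by (rule bounded_linear_intro[of _ "cmod a"])
      (auto simp: norm_cscale ell2.scale_right_distrib scaleR_ell2_def mult.commute)
  define \<eta> where "\<eta> = coord \<phi>2 0 *\<^sub>\<complex> \<phi>1 - coord \<phi>1 0 *\<^sub>\<complex> \<phi>2"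
  have "(\<lambda>k. (coord \<phi>2 0 * ev k - coord \<phi>1 0 * od k) *\<^sub>\<complex> jacobi c (\<psi> k)) sums jacobi c \<eta>"
    using sums_diff[OF bounded_linear.sums[OF bl[of "coord \<phi>2 0"] \<phi>1] bounded_linear.sums[OF bl[of "coord \<phi>1 0"] \<phi>2]]
    by (simp add: \<eta>_def jacobi_diff[OF c] jacobi_cscale[OF c] ell2.scale_left_diff_distrib)
  from null[OF _ this]
  have lim: "(\<lambda>k. coord \<phi>2 0 * ev k - coord \<phi>1 0 * od k) \<longlonglongrightarrow> 0"
    by (simp add: \<eta>_def)
  \<comment> \<open>On odd indices the coefficient is constantly \<open>- coord \<phi>1 0\<close>.
    Once this is 0, the preimage \<open>\<phi>1\<close> alone gives the contradiction.\<close>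
  have "(\<lambda>k. coord \<phi>2 0 * ev (2 * k + 1) - coord \<phi>1 0 * od (2 * k + 1)) \<longlonglongrightarrow> 0"
    using LIMSEQ_subseq_LIMSEQ[OF lim, of "\<lambda>k. 2 * k + 1"] by (simp add: strict_mono_def o_def)
  then have "coord \<phi>1 0 = 0"
    by (simp add: ev_def od_def LIMSEQ_const_iff)
  from null[OF this \<phi>1] have lim: "ev \<longlonglongrightarrow> 0" .
  have "(\<lambda>k. ev (2 * k)) \<longlonglongrightarrow> 0"
    using LIMSEQ_subseq_LIMSEQ[OF lim, of "\<lambda>k. 2 * k"] by (simp add: strict_mono_def o_def)
  then show False
    by (simp add: ev_def LIMSEQ_const_iff)
qed

section \<open>Approximate eigenvalues of the doubling model\<close>

definition doubling_diag :: "(real \<Rightarrow> real) \<Rightarrow> real \<Rightarrow> real \<Rightarrow> nat \<Rightarrow> complex" where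
  "doubling_diag f E x n = complex_of_real (f (2 ^ n * x) - E)"

text \<open>Approximate eigenvalues of the whole-line operators over the natural extension of the doubling
  map: the condition \<open>coord \<psi> 0 = 0\<close> removes the effect of the boundary.\<close>

definition approximate_spectrum :: "(real \<Rightarrow> real) \<Rightarrow> real set" where
  "approximate_spectrum f = {E. \<forall>\<epsilon>>0. \<exists>x \<psi> L. coord \<psi> 0 = 0 \<and> (\<forall>n>L. coord \<psi> n = 0) \<and>
     norm \<psi> = 1 \<and> norm (jacobi (doubling_diag f E x) \<psi>) < \<epsilon>}"

lemma approximate_spectrumD:
  assumes "E \<in> approximate_spectrum f" and "\<epsilon> > 0"
  shows "\<exists>x \<psi> L. coord \<psi> 0 = 0 \<and> (\<forall>n>L. coord \<psi> n = 0) \<and>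
     norm \<psi> = 1 \<and> norm (jacobi (doubling_diag f E x) \<psi>) < \<epsilon>"
  using assms by (simp add: approximate_spectrum_def)

text \<open>Density of every tail, modulo integers, so that test vectors can be placed arbitrarily
  far from the boundary.\<close>

definition dense_orbit :: "real \<Rightarrow> bool" where
  "dense_orbit \<omega> \<longleftrightarrow> (\<forall>N x \<delta>. \<delta> > 0 \<longrightarrow> (\<exists>m\<ge>N. \<exists>p::int. \<bar>2 ^ m * \<omega> - (x + real_of_int p)\<bar> < \<delta>))"

lemma circle_continuous_shift_int:
  assumes "circle_continuous f"
  shows "f (x + real_of_int p) = f x"
proof -
  have per: "f (x + 1) = f x" for x
    using assms by (simp add: circle_continuous_def)
  show ?thesis
  proof (induction p arbitrary: x rule: int_induct[where k = 0])
    case (step1 i)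
    have "f (x + 1 + real_of_int i) = f (x + 1)" by (rule step1)
    then show ?case using per[of x] by (simp add: algebra_simps)
  next
    case (step2 i)
    have "f (x - 1 + real_of_int i) = f (x - 1)" by (rule step2)
    then show ?case using per[of "x - 1"] by (simp add: algebra_simps)
  qed simp
qed

lemma doubling_diag_bounded:
  assumes "circle_continuous f"
  obtains M where "\<And>x n. cmod (doubling_diag f E x n) \<le> M"
proof -
  obtain C where C: "\<And>x. \<bar>f x\<bar> \<le> C"
    using bounded_range_circle_continuous[OF assms] by (auto simp: bounded_iff)
  have "cmod (doubling_diag f E x n) \<le> C + \<bar>E\<bar>" for x n
    using C[of "2 ^ n * x"] unfolding doubling_diag_def norm_of_real by linarith
  then show ?thesis by (rule that)
qed

lemma bounded_doubling_diag:
  "circle_continuous f \<Longrightarrow> bounded (range (doubling_diag f E x))"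
  by (rule doubling_diag_bounded[of f E]) (auto simp: bounded_iff)

text \<open>A test vector supported up to \<open>L\<close> sees only finitely many values of
  \<open>f\<close>, and these change little when \<open>x\<close> is replaced by an orbit point
  close to it modulo integers.\<close>

lemma approximate_spectrum_dense_orbit:
  assumes f: "circle_continuous f" and \<omega>: "dense_orbit \<omega>"
    and E: "E \<in> approximate_spectrum f" and "\<epsilon> > 0"
  obtains m \<psi> L where "m \<ge> N" "coord \<psi> 0 = 0" "\<And>n. n > L \<Longrightarrow> coord \<psi> n = 0" "norm \<psi> = 1"
    "norm (jacobi (doubling_diag f E (2 ^ m * \<omega>)) \<psi>) < \<epsilon>"
proof -
  obtain x \<psi> L where \<psi>: "coord \<psi> 0 = 0" "\<And>n. n > L \<Longrightarrow> coord \<psi> n = 0" "norm \<psi> = 1"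
    "norm (jacobi (doubling_diag f E x) \<psi>) < \<epsilon> / 2"
    using approximate_spectrumD[OF E half_gt_zero[OF \<open>\<epsilon> > 0\<close>]] by blast
  have "\<forall>\<^sub>F y in nhds x. \<forall>n\<in>{..L}. dist (f (2 ^ n * y)) (f (2 ^ n * x)) < \<epsilon> / 2"
  proof (intro eventually_ball_finite ballI tendstoD)
    fix n
    have "continuous_on UNIV (\<lambda>y. f (2 ^ n * y))"
      using f by (intro continuous_on_compose2[of UNIV f UNIV "\<lambda>y. 2 ^ n * y"] continuous_on_mult_left continuous_on_id)
        (auto simp: circle_continuous_def)
    then show "((\<lambda>y. f (2 ^ n * y)) \<longlongrightarrow> f (2 ^ n * x)) (nhds x)"
      by (intro tendsto_at_iff_tendsto_nhds[where g = "\<lambda>y. f (2 ^ n * y)", THEN iffD1])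
        (simp add: continuous_on_eq_continuous_at isCont_def)
  qed (use \<open>\<epsilon> > 0\<close> in auto)
  then obtain \<delta> where \<delta>: "\<delta> > 0"
    "\<And>y n. dist y x < \<delta> \<Longrightarrow> n \<le> L \<Longrightarrow> dist (f (2 ^ n * y)) (f (2 ^ n * x)) < \<epsilon> / 2"
    unfolding eventually_nhds_metric by auto
  obtain m p where m: "m \<ge> N" "\<bar>2 ^ m * \<omega> - (x + real_of_int p)\<bar> < \<delta>"
    using \<omega> \<delta>(1) unfolding dense_orbit_def by metis
  \<comment> \<open>The difference of the diagonals is cut off where \<psi> ends: only up to
    \<open>L\<close> is it known to be small.\<close>
  define d where "d n = (if n \<le> L then doubling_diag f E (2 ^ m * \<omega>) n - doubling_diag f E x n else 0)" for n
  have d: "cmod (d n) \<le> \<epsilon> / 2" for n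
  proof (cases "n \<le> L")
    case True
    have "2 ^ n * (2 ^ m * \<omega>) = 2 ^ n * (2 ^ m * \<omega> - real_of_int p) + real_of_int (2 ^ n * p)"
      by (simp add: algebra_simps)
    then have "f (2 ^ n * (2 ^ m * \<omega>)) = f (2 ^ n * (2 ^ m * \<omega> - real_of_int p))"
      by (simp only: circle_continuous_shift_int[OF f])
    moreover have "dist (f (2 ^ n * (2 ^ m * \<omega> - real_of_int p))) (f (2 ^ n * x)) < \<epsilon> / 2"
      by (rule \<delta>(2)[OF _ True]) (use m(2) in \<open>simp add: dist_real_def algebra_simps\<close>)
    ultimately show ?thesis
      using True by (simp add: d_def doubling_diag_def dist_real_def flip: of_real_diff)
  qed (use \<open>\<epsilon> > 0\<close> in \<open>simp add: d_def\<close>)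
  have "jacobi (doubling_diag f E (2 ^ m * \<omega>)) \<psi> = jacobi (doubling_diag f E x) \<psi> + diag d \<psi>"
  proof (rule ell2_eqI)
    fix n
    show "coord (jacobi (doubling_diag f E (2 ^ m * \<omega>)) \<psi>) n
        = coord (jacobi (doubling_diag f E x) \<psi> + diag d \<psi>) n"
      using \<psi>(2)[of n]
      by (cases "n \<le> L")
        (auto simp: coord_jacobi[OF bounded_doubling_diag[OF f]] diag_bounded(1)[OF d] d_def algebra_simps)
  qed
  then have "norm (jacobi (doubling_diag f E (2 ^ m * \<omega>)) \<psi>)
      \<le> norm (jacobi (doubling_diag f E x) \<psi>) + norm (diag d \<psi>)"
    by (simp add: norm_triangle_ineq)
  then have "norm (jacobi (doubling_diag f E (2 ^ m * \<omega>)) \<psi>) < \<epsilon>"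
    using diag_bounded(2)[of d "\<epsilon> / 2" \<psi>, OF d] \<psi>(3,4) by simp
  then show ?thesis using that m(1) \<psi> by blast
qed

text \<open>The shift could create an extra entry only in row \<open>m - 1\<close>, namely
  \<open>coord \<psi> 0\<close>, which vanishes.\<close>

lemma jacobi_rshift:
  assumes "circle_continuous f" and "coord \<psi> 0 = 0"
  shows "jacobi (doubling_diag f E \<omega>) (rshift m \<psi>) = rshift m (jacobi (doubling_diag f E (2 ^ m * \<omega>)) \<psi>)"
proof (rule ell2_eqI)
  fix n
  consider "Suc n < m" | "Suc n = m" | "n = m" | "n > m" by linarith
  then show "coord (jacobi (doubling_diag f E \<omega>) (rshift m \<psi>)) n
      = coord (rshift m (jacobi (doubling_diag f E (2 ^ m * \<omega>)) \<psi>)) n"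
    using assms(2)
    by cases (auto simp: coord_jacobi[OF bounded_doubling_diag[OF assms(1)]] doubling_diag_def
        Suc_diff_le power_add[symmetric] mult.assoc[symmetric])
qed

text \<open>One \<epsilon> serves all \<open>x\<close> because \<open>approximate_spectrum\<close>
  quantifies over all base points at once. The adjoint carries the perturbation
  \<open>- \<i>\<close>, whence the two signs in the proof.\<close>

lemma bounded_below_outside_approximate_spectrum:
  assumes f: "circle_continuous f" and E: "E \<notin> approximate_spectrum f"
  obtains \<gamma> where "\<gamma> > 0" "\<And>x \<psi>. \<gamma> * norm \<psi> \<le>
      norm (jacobi ((doubling_diag f E x)(0 := doubling_diag f E x 0 + \<i>)) \<psi>)"
    "\<And>x \<psi>. \<gamma> * norm \<psi> \<le>
      norm (jacobi (\<lambda>n. cnj (((doubling_diag f E x)(0 := doubling_diag f E x 0 + \<i>)) n)) \<psi>)"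
proof -
  obtain \<epsilon> where \<epsilon>: "\<epsilon> > 0" "\<And>x \<psi> L. coord \<psi> 0 = 0 \<Longrightarrow> (\<And>n. n > L \<Longrightarrow> coord \<psi> n = 0) \<Longrightarrow>
     norm \<psi> = 1 \<Longrightarrow> \<epsilon> \<le> norm (jacobi (doubling_diag f E x) \<psi>)"
  proof -
    obtain \<epsilon> where "\<epsilon> > 0" and *: "\<not> (\<exists>x \<psi> L. coord \<psi> 0 = 0 \<and> (\<forall>n>L. coord \<psi> n = 0) \<and>
        norm \<psi> = 1 \<and> norm (jacobi (doubling_diag f E x) \<psi>) < \<epsilon>)"
      using E unfolding approximate_spectrum_def mem_Collect_eq by blast
    show ?thesis
    proof (rule that[OF \<open>\<epsilon> > 0\<close>])
      fix x \<psi> and L :: nat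
      assume "coord \<psi> 0 = 0" "\<And>n. n > L \<Longrightarrow> coord \<psi> n = 0" "norm \<psi> = 1"
      then show "\<epsilon> \<le> norm (jacobi (doubling_diag f E x) \<psi>)"
        using * not_less by blast
    qed
  qed
  note b = bounded_doubling_diag[OF f]
  have low: "\<epsilon> * norm \<psi> \<le> norm (jacobi (doubling_diag f E x) \<psi>)" if "coord \<psi> 0 = 0" for x \<psi>
  proof (rule jacobi_bounded_below_extend[OF b _ that])
    fix \<psi> L assume \<psi>: "coord \<psi> 0 = 0" "\<And>n. n > L \<Longrightarrow> coord \<psi> n = 0"
    show "\<epsilon> * norm \<psi> \<le> norm (jacobi (doubling_diag f E x) \<psi>)"
    proof (cases "\<psi> = 0")
      case False
      define a where "a = complex_of_real (1 / norm \<psi>)"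
      have "\<epsilon> \<le> norm (jacobi (doubling_diag f E x) (a *\<^sub>\<complex> \<psi>))"
        by (rule \<epsilon>(2)[of _ L]) (use \<psi> False in \<open>auto simp: norm_cscale a_def norm_divide\<close>)
      then show ?thesis
        using False by (simp add: jacobi_cscale[OF b] norm_cscale a_def norm_divide field_simps)
    qed simp
  qed
  obtain M where M: "\<And>x n. cmod (doubling_diag f E x n) \<le> M"
    using doubling_diag_bounded[OF f] by blast
  define \<gamma> where "\<gamma> = \<epsilon>\<^sup>2 / (2 * \<epsilon> + (3 + M + \<epsilon>)\<^sup>2)"
  have "\<gamma> > 0" using \<epsilon>(1) by (simp add: \<gamma>_def add_pos_nonneg)
  have main: "\<gamma> * norm \<psi> \<le> norm (jacobi ((doubling_diag f E x)
      (0 := doubling_diag f E x 0 + complex_of_real s * \<i>)) \<psi>)" if "s = 1 \<or> s = - 1" for s x \<psi>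
    unfolding \<gamma>_def
    by (rule jacobi_rank_one_bounded_below[OF M _ \<epsilon>(1) low that]) (simp_all add: doubling_diag_def)
  have "(\<lambda>n. cnj (((doubling_diag f E x)(0 := doubling_diag f E x 0 + \<i>)) n))
      = (doubling_diag f E x)(0 := doubling_diag f E x 0 + complex_of_real (- 1) * \<i>)" for x
    by (auto simp: doubling_diag_def fun_eq_iff)
  then show ?thesis
    using that[OF \<open>\<gamma> > 0\<close>] main[of 1] main[of "- 1"] by simp
qed

text \<open>The right-hand side is free of \<omega>, which yields almost sure constancy. Density
  serves the inclusion from right to left, where test vectors are needed beyond every
  \<open>N\<close>.\<close>

lemma essential_spectrum_dense_orbit:
  assumes f: "circle_continuous f" and \<omega>: "dense_orbit \<omega>"
  shows "essential_spectrum (doubling_operator f \<omega>) = complex_of_real ` approximate_spectrum f"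
proof -
  define V where "V n = f (2 ^ n * \<omega>)" for n
  have V: "bounded (range V)"
    by (rule bounded_subset[OF bounded_range_circle_continuous[OF f]]) (auto simp: V_def)
  have op: "doubling_operator f \<omega> = schroedinger V"
    by (simp add: doubling_operator_def V_def[abs_def])
  have shifted: "(\<lambda>\<psi>. schroedinger V \<psi> - complex_of_real E *\<^sub>\<complex> \<psi>) = jacobi (doubling_diag f E \<omega>)" for E
    unfolding schroedinger_minus_eq_jacobi[OF V]
    by (simp add: V_def doubling_diag_def[abs_def])
  have iff: "complex_of_real E \<in> essential_spectrum (schroedinger V) \<longleftrightarrow> E \<in> approximate_spectrum f" for E
  proof
    assume *: "complex_of_real E \<in> essential_spectrum (schroedinger V)"
    show "E \<in> approximate_spectrum f"
    proof (rule ccontr)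
      assume "E \<notin> approximate_spectrum f"
      from bounded_below_outside_approximate_spectrum[OF f this]
      have "fredholm (jacobi (doubling_diag f E \<omega>))"
        by (metis fredholm_jacobi[OF bounded_doubling_diag[OF f]])
      then show False using * by (simp add: essential_spectrum_def shifted)
    qed
  next
    assume E: "E \<in> approximate_spectrum f"
    have "\<not> fredholm (jacobi (doubling_diag f E \<omega>))"
    proof (rule not_fredholm_jacobi[OF bounded_doubling_diag[OF f]])
      fix N and \<epsilon> :: real assume "\<epsilon> > 0"
      obtain m \<psi> L where \<psi>: "m \<ge> N" "coord \<psi> 0 = 0" "\<And>n. n > L \<Longrightarrow> coord \<psi> n = 0" "norm \<psi> = 1"
        "norm (jacobi (doubling_diag f E (2 ^ m * \<omega>)) \<psi>) < \<epsilon>"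
        using approximate_spectrum_dense_orbit[OF f \<omega> E \<open>\<epsilon> > 0\<close>] by metis
      have "coord (rshift m \<psi>) n = 0" if "n \<le> N" for n
        using that \<psi>(1,2) by (cases "n < m") auto
      moreover have "coord (rshift m \<psi>) n = 0" if "n > m + L" for n
        using that \<psi>(3)[of "n - m"] by auto
      ultimately show "\<exists>\<psi> L. (\<forall>n\<le>N. coord \<psi> n = 0) \<and> (\<forall>n>L. coord \<psi> n = 0) \<and>
          norm \<psi> = 1 \<and> norm (jacobi (doubling_diag f E \<omega>) \<psi>) < \<epsilon>"
        using \<psi>(4,5) by (intro exI[of _ "rshift m \<psi>"] exI[of _ "m + L"]) (auto simp: jacobi_rshift[OF f \<psi>(2)])
    qed
    then show "complex_of_real E \<in> essential_spectrum (schroedinger V)"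
      by (simp add: essential_spectrum_def shifted)
  qed
  show ?thesis
    unfolding op
  proof (intro set_eqI iffI)
    fix z assume z: "z \<in> essential_spectrum (schroedinger V)"
    then have "z = complex_of_real (Re z)"
      using essential_spectrum_real[OF V z] by (simp add: complex_eq_iff)
    then show "z \<in> complex_of_real ` approximate_spectrum f"
      using z iff by (metis imageI)
  qed (use iff in auto)
qed


section \<open>Almost every orbit is dense\<close>

text \<open>The set of points of \<open>[0,1)\<close> whose orbit avoids a dyadic interval of length \<open>2\<^sup>-\<^sup>k\<close> is covered by
  \<open>2\<^sup>k - 1\<close> copies of itself scaled by \<open>2\<^sup>-\<^sup>k\<close>.\<close>

lemma negligible_avoids_dyadic_unit:
  fixes j :: int
  assumes j: "0 \<le> j" "j < 2 ^ k"
  defines "S \<equiv> {\<omega>::real. 0 \<le> \<omega> \<and> \<omega> < 1 \<and> (\<forall>m. \<lfloor>2 ^ k * frac (2 ^ m * \<omega>)\<rfloor> \<noteq> j)}"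
  shows "negligible S"
proof -
  define J where "J = {0..<2 ^ k} - {j}"
  \<comment> \<open>The inverse branches of \<omega> \<mapsto>
    \<open>frac (2 ^ k * \<omega>)\<close>, a map that sends \<open>S\<close> into itself; no point
    of \<open>S\<close> lies in branch \<open>j\<close>.\<close>
  define \<phi> where "\<phi> i x = (1 / 2 ^ k) *\<^sub>R x + real_of_int i / 2 ^ k" for i x
  define q :: real where "q = (2 ^ k - 1) / 2 ^ k"
  have cover: "S \<subseteq> (\<Union>i\<in>J. \<phi> i ` S)"
  proof
    fix \<omega> assume \<omega>: "\<omega> \<in> S"
    define i where "i = \<lfloor>2 ^ k * \<omega>\<rfloor>"
    have 01: "0 \<le> \<omega>" "\<omega> < 1" using \<omega> by (auto simp: S_def)
    have "0 \<le> i" using 01 by (simp add: i_def)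
    moreover have "i < 2 ^ k"
      using 01 unfolding i_def floor_less_iff by simp
    moreover have "i \<noteq> j"
      using \<omega> 01 unfolding S_def i_def by (auto dest!: spec[of _ 0] simp: frac_eq_id)
    ultimately have i: "i \<in> J" by (simp add: J_def)
    have "frac (2 ^ m * frac (2 ^ k * \<omega>)) = frac (2 ^ (m + k) * \<omega>)" for m
    proof -
      have "2 ^ m * frac (2 ^ k * \<omega>) = 2 ^ (m + k) * \<omega> + real_of_int (- (2 ^ m * \<lfloor>2 ^ k * \<omega>\<rfloor>))"
        by (simp add: frac_def power_add algebra_simps)
      then show ?thesis by (simp only: frac_add_of_int_right)
    qed
    then have "frac (2 ^ k * \<omega>) \<in> S"
      using \<omega> by (simp add: S_def frac_lt_1)
    moreover have "\<omega> = \<phi> i (frac (2 ^ k * \<omega>))"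
      by (simp add: \<phi>_def i_def frac_def field_simps)
    ultimately show "\<omega> \<in> (\<Union>i\<in>J. \<phi> i ` S)" using i by blast
  qed
  have card: "real (card J) = 2 ^ k - 1"
    using j by (simp add: J_def card_Diff_singleton of_nat_diff)
  have "finite J" by (simp add: J_def)
  \<comment> \<open>Compact covers are measured instead of \<open>S\<close>, which keeps
    measurability out of the induction. Each round multiplies the bound by \<open>q\<close>, the
    fraction of branches left.\<close>
  have approx: "\<exists>T. compact T \<and> S \<subseteq> T \<and> measure lebesgue T \<le> q ^ n" for n
  proof (induction n)
    case 0
    show ?case by (intro exI[of _ "{0..1}"]) (auto simp: S_def)
  next
    case (Suc n)
    then obtain T where T: "compact T" "S \<subseteq> T" "measure lebesgue T \<le> q ^ n" by blast
    have \<phi>T: "compact (\<phi> i ` T)" for i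
      unfolding \<phi>_def by (intro compact_continuous_image continuous_intros T)
    have "measure lebesgue (\<phi> i ` T) = measure lebesgue T / 2 ^ k" for i
      using measure_lebesgue_affine[of "1 / 2 ^ k" "real_of_int i / 2 ^ k" T] by (simp add: \<phi>_def)
    then have "measure lebesgue (\<Union>i\<in>J. \<phi> i ` T) \<le> (\<Sum>i\<in>J. measure lebesgue T / 2 ^ k)"
      using measure_UNION_le[OF \<open>finite J\<close>, of "\<lambda>i. \<phi> i ` T" lebesgue] \<phi>T
      by (simp add: compact_imp_closed borel_closed)
    also have "\<dots> = q * measure lebesgue T"
      by (simp add: card q_def)
    also have "\<dots> \<le> q * q ^ n"
      by (intro mult_left_mono T) (simp add: q_def)
    finally have "measure lebesgue (\<Union>i\<in>J. \<phi> i ` T) \<le> q ^ Suc n" by simp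
    moreover have "S \<subseteq> (\<Union>i\<in>J. \<phi> i ` T)" using cover T(2) by blast
    ultimately show ?case
      using \<phi>T \<open>finite J\<close> by (intro exI[of _ "\<Union>i\<in>J. \<phi> i ` T"]) auto
  qed
  show ?thesis
    unfolding negligible_outer
  proof (intro allI impI)
    fix e :: real assume "e > 0"
    then obtain n where "q ^ n < e"
      using real_arch_pow_inv[of e q] by (auto simp: q_def)
    then show "\<exists>T. S \<subseteq> T \<and> T \<in> lmeasurable \<and> measure lebesgue T < e"
      using approx[of n] lmeasurable_compact by (meson le_less_trans)
  qed
qed

text \<open>After \<open>N\<close> doublings and reduction modulo 1 the point lies in the
  unit-interval set; integer translations and scaling by \<open>2 ^ N\<close> preserve null
  sets.\<close>

lemma negligible_avoids_dyadic:
  fixes j :: int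
  assumes "0 \<le> j" "j < 2 ^ k"
  shows "negligible {\<omega>::real. \<forall>m\<ge>N. \<lfloor>2 ^ k * frac (2 ^ m * \<omega>)\<rfloor> \<noteq> j}"
proof -
  define S where "S = {\<omega>::real. 0 \<le> \<omega> \<and> \<omega> < 1 \<and> (\<forall>m. \<lfloor>2 ^ k * frac (2 ^ m * \<omega>)\<rfloor> \<noteq> j)}"
  define B where "B = (\<Union>p\<in>range real_of_int. (+) p ` S)"
  have "negligible B"
    unfolding B_def
    by (intro negligible_countable_Union)
      (auto intro!: negligible_translation simp: S_def negligible_avoids_dyadic_unit[OF assms])
  then have "negligible ((\<lambda>x. x / 2 ^ N) ` B)"
    by (rule negligible_differentiable_image_negligible[OF order_refl])
      (simp add: divide_inverse linear_imp_differentiable_on linear_iff algebra_simps)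
  moreover have "{\<omega>::real. \<forall>m\<ge>N. \<lfloor>2 ^ k * frac (2 ^ m * \<omega>)\<rfloor> \<noteq> j} \<subseteq> (\<lambda>x. x / 2 ^ N) ` B"
  proof
    fix \<omega> :: real assume \<omega>: "\<omega> \<in> {\<omega>. \<forall>m\<ge>N. \<lfloor>2 ^ k * frac (2 ^ m * \<omega>)\<rfloor> \<noteq> j}"
    have "frac (2 ^ m * frac (2 ^ N * \<omega>)) = frac (2 ^ (m + N) * \<omega>)" for m
    proof -
      have "2 ^ m * frac (2 ^ N * \<omega>) = 2 ^ (m + N) * \<omega> + real_of_int (- (2 ^ m * \<lfloor>2 ^ N * \<omega>\<rfloor>))"
        by (simp add: frac_def power_add algebra_simps)
      then show ?thesis by (simp only: frac_add_of_int_right)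
    qed
    then have "frac (2 ^ N * \<omega>) \<in> S"
      using \<omega> by (simp add: S_def frac_lt_1)
    moreover have "2 ^ N * \<omega> = real_of_int \<lfloor>2 ^ N * \<omega>\<rfloor> + frac (2 ^ N * \<omega>)"
      by (simp add: frac_def)
    ultimately have "2 ^ N * \<omega> \<in> B" unfolding B_def by blast
    then show "\<omega> \<in> (\<lambda>x. x / 2 ^ N) ` B" by (intro image_eqI[of _ _ "2 ^ N * \<omega>"]) auto
  qed
  ultimately show ?thesis by (rule negligible_subset)
qed

lemma dense_orbitI:
  assumes "\<And>N k j. 0 \<le> j \<Longrightarrow> j < 2 ^ k \<Longrightarrow> \<exists>m\<ge>N. \<lfloor>2 ^ k * frac (2 ^ m * \<omega>)\<rfloor> = j"
  shows "dense_orbit \<omega>"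
  unfolding dense_orbit_def
proof (intro allI impI)
  fix N and x \<delta> :: real assume "\<delta> > 0"
  obtain k where k: "(1/2) ^ k < \<delta>"
    using real_arch_pow_inv[OF \<open>\<delta> > 0\<close>, of "1/2"] by auto
  define j where "j = \<lfloor>2 ^ k * frac x\<rfloor>"
  have "0 \<le> j" by (simp add: j_def)
  moreover have "j < 2 ^ k"
    unfolding j_def floor_less_iff by (simp add: frac_lt_1)
  ultimately obtain m where m: "m \<ge> N" "\<lfloor>2 ^ k * frac (2 ^ m * \<omega>)\<rfloor> = j"
    using assms by blast
  have "\<bar>2 ^ k * frac (2 ^ m * \<omega>) - 2 ^ k * frac x\<bar> < 1"
    using m(2) unfolding j_def by linarith
  then have "2 ^ k * \<bar>frac (2 ^ m * \<omega>) - frac x\<bar> < 1"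
    by (simp add: abs_mult flip: right_diff_distrib)
  then have "\<bar>frac (2 ^ m * \<omega>) - frac x\<bar> < (1/2) ^ k"
    by (simp add: power_divide field_simps)
  then have "\<bar>2 ^ m * \<omega> - (x + real_of_int (\<lfloor>2 ^ m * \<omega>\<rfloor> - \<lfloor>x\<rfloor>))\<bar> < \<delta>"
    using k by (simp add: frac_def algebra_simps)
  then show "\<exists>m\<ge>N. \<exists>p::int. \<bar>2 ^ m * \<omega> - (x + real_of_int p)\<bar> < \<delta>"
    using m(1) by blast
qed

lemma AE_dense_orbit: "AE \<omega> in lebesgue. dense_orbit \<omega>"
proof -
  define Bad where "Bad = (\<lambda>(N, k, j). {\<omega>::real. 0 \<le> j \<and> j < 2 ^ k \<and>
    (\<forall>m\<ge>N. \<lfloor>2 ^ k * frac (2 ^ m * \<omega>)\<rfloor> \<noteq> j)})"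
  have "negligible (Bad p)" for p :: "nat \<times> nat \<times> int"
  proof (cases p)
    case (fields N k j)
    show ?thesis
      by (cases "0 \<le> j \<and> j < 2 ^ k") (auto simp: Bad_def fields negligible_avoids_dyadic)
  qed
  then have "negligible (\<Union>(range Bad))"
    by (intro negligible_countable_Union) auto
  moreover have "{\<omega>. \<not> dense_orbit \<omega>} \<subseteq> \<Union>(range Bad)"
  proof
    fix \<omega> assume "\<omega> \<in> {\<omega>. \<not> dense_orbit \<omega>}"
    then obtain N k j where "0 \<le> j" "j < 2 ^ k" "\<forall>m\<ge>N. \<lfloor>2 ^ k * frac (2 ^ m * \<omega>)\<rfloor> \<noteq> j"
      using dense_orbitI[of \<omega>] by blast
    then have "\<omega> \<in> Bad (N, k, j)" by (simp add: Bad_def)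
    then show "\<omega> \<in> \<Union>(range Bad)" by blast
  qed
  ultimately show ?thesis
    unfolding eventually_ae_filter_negligible by blast
qed

lemma not_negligible_unit_interval: "\<not> negligible {0..<1::real}"
  by (simp add: negligible_iff_measure)

lemma almost_sure_essential_spectrum_eq:
  assumes "circle_continuous f"
  shows "almost_sure_essential_spectrum f = approximate_spectrum f"
  unfolding almost_sure_essential_spectrum_def
proof (rule the_equality)
  have "AE \<omega> in lebesgue. \<omega> \<in> {0..<1} \<longrightarrow>
      essential_spectrum (doubling_operator f \<omega>) = complex_of_real ` approximate_spectrum f"
    using AE_dense_orbit by eventually_elim (simp add: essential_spectrum_dense_orbit[OF assms])
  then show ae: "AE \<omega> in lebesgue_on {0..<1}.
      essential_spectrum (doubling_operator f \<omega>) = complex_of_real ` approximate_spectrum f"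
    by (simp add: AE_restrict_space_iff)
  fix \<Sigma> assume "AE \<omega> in lebesgue_on {0..<1}.
      essential_spectrum (doubling_operator f \<omega>) = complex_of_real ` \<Sigma>"
  with ae have "AE \<omega> in lebesgue_on {0..<1::real}.
      complex_of_real ` \<Sigma> = complex_of_real ` approximate_spectrum f"
    by eventually_elim simp
  then have "AE \<omega> in lebesgue. \<omega> \<in> {0..<1::real} \<longrightarrow>
      complex_of_real ` \<Sigma> = complex_of_real ` approximate_spectrum f"
    by (simp add: AE_restrict_space_iff)
  then obtain N :: "real set" where "negligible N" "{\<omega>. \<not> (\<omega> \<in> {0..<1} \<longrightarrow>
      complex_of_real ` \<Sigma> = complex_of_real ` approximate_spectrum f)} \<subseteq> N"
    unfolding eventually_ae_filter_negligible by blast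
  \<comment> \<open>The equation of sets does not mention \<omega>, so one point of the interval
    outside \<open>N\<close> settles it.\<close>
  moreover have "\<not> {0..<1} \<subseteq> N"
    using \<open>negligible N\<close> negligible_subset not_negligible_unit_interval by blast
  ultimately have "complex_of_real ` \<Sigma> = complex_of_real ` approximate_spectrum f"
    by blast
  then show "\<Sigma> = approximate_spectrum f"
    by (simp add: inj_image_eq_iff inj_of_real)
qed

lemma ex_dense_orbit: "\<exists>\<omega>. dense_orbit \<omega>"
proof -
  obtain N where "negligible N" "{\<omega>. \<not> dense_orbit \<omega>} \<subseteq> N"
    using AE_dense_orbit unfolding eventually_ae_filter_negligible by blast
  moreover have "N \<noteq> UNIV"
    using \<open>negligible N\<close> negligible_subset not_negligible_unit_interval by blast
  ultimately show ?thesis by blast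
qed


section \<open>The stable direction and its angle\<close>

text \<open>Finitely many entries become small, and the rest of \<psi> has small norm. Convergence
  on a fixed vector is the right notion, since \<open>f (2 ^ n * y)\<close> tends to
  \<open>f (2 ^ n * x)\<close> for each \<open>n\<close> but in general not uniformly in
  \<open>n\<close>.\<close>

lemma norm_diag_tendsto_zero:
  assumes C: "\<And>y n. cmod (c y n) \<le> C" and lim: "\<And>n. ((\<lambda>y. c y n) \<longlongrightarrow> 0) F"
  shows "((\<lambda>y. norm (diag (c y) \<psi>)) \<longlongrightarrow> 0) F"
proof (rule tendstoI)
  fix e :: real assume "e > 0"
  have "(\<lambda>N. C * norm (\<psi> - trunc N \<psi>)) \<longlonglongrightarrow> C * norm (\<psi> - \<psi>)"
    by (intro tendsto_intros trunc_tendsto)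
  then have "(\<lambda>N. C * norm (\<psi> - trunc N \<psi>)) \<longlonglongrightarrow> 0" by simp
  then have "\<forall>\<^sub>F N in sequentially. C * norm (\<psi> - trunc N \<psi>) < e / 2"
    using \<open>e > 0\<close> by (intro order_tendstoD(2)) auto
  then obtain N where N: "C * norm (\<psi> - trunc N \<psi>) < e / 2"
    by (auto simp: eventually_sequentially)
  obtain K where K: "K > 0" "norm \<psi> \<le> K"
    by (meson gt_ex le_less_trans less_imp_le norm_ge_zero)
  define \<delta> where "\<delta> = e / (2 * K)"
  have "\<delta> > 0" using \<open>e > 0\<close> K(1) by (simp add: \<delta>_def)
  then have "\<delta> * norm \<psi> \<le> \<delta> * K" using K(2) by (intro mult_left_mono) auto
  also have "\<dots> = e / 2" using K(1) by (simp add: \<delta>_def)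
  finally have \<delta>: "\<delta> * norm \<psi> \<le> e / 2" .
  have "\<forall>\<^sub>F y in F. \<forall>n\<in>{..<N}. dist (c y n) 0 < \<delta>"
    by (intro eventually_ball_finite ballI tendstoD[OF lim] \<open>\<delta> > 0\<close>) simp
  then show "\<forall>\<^sub>F y in F. dist (norm (diag (c y) \<psi>)) 0 < e"
  proof eventually_elim
    case (elim y)
    define d where "d n = (if n < N then c y n else 0)" for n
    have d: "cmod (d n) \<le> \<delta>" for n
      using elim \<open>\<delta> > 0\<close> by (simp add: d_def less_imp_le)
    have "diag (c y) \<psi> = diag d \<psi> + diag (c y) (\<psi> - trunc N \<psi>)"
      by (rule ell2_eqI)
        (simp only: coord_simps diag_bounded(1)[of d \<delta>, OF d] diag_bounded(1)[of "c y" C, OF C], simp add: d_def)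
    then have "norm (diag (c y) \<psi>) \<le> norm (diag d \<psi>) + norm (diag (c y) (\<psi> - trunc N \<psi>))"
      by (simp add: norm_triangle_ineq)
    then show ?case
      using diag_bounded(2)[of d \<delta> \<psi>, OF d] diag_bounded(2)[of "c y" C "\<psi> - trunc N \<psi>", OF C] \<delta> N
      by simp
  qed
qed

text \<open>Decaying solutions of a second-order recursion are unique up to a factor, because their
  Wronskian is constant.\<close>

lemma decaying_solutions_proportional:
  fixes u v a :: "nat \<Rightarrow> complex"
  assumes "u \<longlonglongrightarrow> 0" and "v \<longlonglongrightarrow> 0"
    and u: "\<And>n. u (Suc (Suc n)) + u n + a n * u (Suc n) = 0"
    and v: "\<And>n. v (Suc (Suc n)) + v n + a n * v (Suc n) = 0"
  shows "u 0 * v 1 = u 1 * v 0"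
proof -
  define W where "W n = u n * v (Suc n) - u (Suc n) * v n" for n
  have u': "u (Suc (Suc n)) = - u n - a n * u (Suc n)" for n
    using u[of n] by (simp add: algebra_simps eq_neg_iff_add_eq_0)
  have v': "v (Suc (Suc n)) = - v n - a n * v (Suc n)" for n
    using v[of n] by (simp add: algebra_simps eq_neg_iff_add_eq_0)
  have "W (Suc n) = W n" for n
    unfolding W_def u' v' by (simp add: algebra_simps)
  then have "W n = W 0" for n by (induction n) auto
  moreover have "W \<longlonglongrightarrow> 0 * 0 - 0 * 0"
    unfolding W_def[abs_def] by (intro tendsto_intros assms(1,2) LIMSEQ_Suc)
  ultimately have "W 0 = 0"
    by (metis LIMSEQ_const_iff LIMSEQ_unique diff_self ext mult_zero_left)
  then show ?thesis by (simp add: W_def)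
qed

text \<open>The sequence \<open>coord (G x)\<close> is the decaying solution of the difference equation over the forward
  orbit of \<open>x\<close>. Its initial direction is the stable direction of the cocycle; it depends on \<open>x\<close> alone
  and not on a choice of preimages, so it lives on the circle rather than on the natural extension.\<close>

lemma decaying_solution_exists:
  assumes f: "circle_continuous f" and E: "E \<notin> approximate_spectrum f"
  obtains G where
    "\<And>x n. coord (G x) (Suc (Suc n)) + coord (G x) n
        + complex_of_real (f (2 ^ Suc n * x) - E) * coord (G x) (Suc n) = 0"
    "\<And>x. coord (G x) 0 \<noteq> 0 \<or> coord (G x) 1 \<noteq> 0"
    "\<And>x. G (x + 1) = G x"
    "\<And>n. continuous_on UNIV (\<lambda>x. coord (G x) n)"
proof -
  define D where "D x = (doubling_diag f E x)(0 := doubling_diag f E x 0 + \<i>)" for x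
  obtain \<gamma> where "\<gamma> > 0" and low: "\<And>x \<psi>. \<gamma> * norm \<psi> \<le> norm (jacobi (D x) \<psi>)"
    and low_adj: "\<And>x \<psi>. \<gamma> * norm \<psi> \<le> norm (jacobi (\<lambda>n. cnj (D x n)) \<psi>)"
    using bounded_below_outside_approximate_spectrum[OF f E] unfolding D_def by blast
  have D: "bounded (range (D x))" for x
    by (rule bounded_subset[of "insert (doubling_diag f E x 0 + \<i>) (range (doubling_diag f E x))"])
      (use bounded_doubling_diag[OF f] in \<open>auto simp: D_def\<close>)
  \<comment> \<open>Column 0 of the inverse of the perturbed operator. Its rows from 1 on are the
    unperturbed difference equation, and the 1 in row 0 keeps the entries 0 and 1 from vanishing
    together.\<close>
  define G where "G x = (SOME g. jacobi (D x) g = unit_ell2)" for x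
  have G: "jacobi (D x) (G x) = unit_ell2" for x
  proof -
    have "surj (jacobi (D x))"
      by (rule surj_of_adjoint_bounded_below[OF bounded_linear_jacobi[OF D]
            bounded_linear_jacobi[OF bounded_range_cnj[OF D]] inner_jacobi[OF D] low_adj \<open>\<gamma> > 0\<close>])
    then obtain g where "jacobi (D x) g = unit_ell2" by (metis surjD)
    then show ?thesis unfolding G_def by (rule someI)
  qed
  have coord_G: "coord (jacobi (D x) (G x)) n = (if n = 0 then 1 else 0)" for x n
    by (simp add: G)
  show ?thesis
  proof (rule that[of G])
    show "coord (G x) (Suc (Suc n)) + coord (G x) n
        + complex_of_real (f (2 ^ Suc n * x) - E) * coord (G x) (Suc n) = 0" for x n
      using coord_G[of x "Suc n"]
      unfolding coord_jacobi[OF D] by (simp add: D_def doubling_diag_def)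
    show "coord (G x) 0 \<noteq> 0 \<or> coord (G x) 1 \<noteq> 0" for x
      using coord_G[of x 0] unfolding coord_jacobi[OF D] by auto
    show "G (x + 1) = G x" for x
    proof -
      have "f (2 ^ n * (x + 1)) = f (2 ^ n * x)" for n
        using circle_continuous_shift_int[OF f, of "2 ^ n * x" "2 ^ n"] by (simp add: algebra_simps)
      then have "doubling_diag f E (x + 1) = doubling_diag f E x"
        by (simp add: doubling_diag_def[abs_def])
      then show ?thesis by (simp add: G_def D_def)
    qed
    obtain M where M: "\<And>x n. cmod (doubling_diag f E x n) \<le> M"
      using doubling_diag_bounded[OF f] by blast
    have "isCont (\<lambda>x. coord (G x) n) x" for x n
    proof -
      define d where "d y n = doubling_diag f E x n - doubling_diag f E y n" for y n
      have d: "cmod (d y n) \<le> M + M" for y n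
        unfolding d_def by (rule order.trans[OF norm_triangle_ineq4 add_mono[OF M M]])
      \<comment> \<open>Resolvent identity; \<gamma> does not depend on \<open>y\<close>.\<close>
      have bound: "norm (G y - G x) \<le> norm (diag (d y) (G x)) / \<gamma>" for y
      proof -
        have "jacobi (D y) (G y - G x) = jacobi (D x) (G x) - jacobi (D y) (G x)"
          by (simp add: jacobi_diff[OF D] G)
        also have "\<dots> = diag (d y) (G x)"
          by (rule ell2_eqI)
            (simp only: coord_simps coord_jacobi[OF D] diag_bounded(1)[of "d y" "M + M", OF d],
             simp add: d_def D_def algebra_simps)
        finally show ?thesis
          using low[of "G y - G x" y] \<open>\<gamma> > 0\<close> by (simp add: field_simps)
      qed
      have "((\<lambda>y. norm (diag (d y) (G x)) / \<gamma>) \<longlongrightarrow> 0 / \<gamma>) (at x)"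
      proof (intro tendsto_divide norm_diag_tendsto_zero[OF d] tendsto_const)
        fix n
        have "continuous_on UNIV (\<lambda>y. f (2 ^ n * y))"
          using f by (intro continuous_on_compose2[of UNIV f UNIV "\<lambda>y. 2 ^ n * y"] continuous_on_mult_left continuous_on_id)
            (auto simp: circle_continuous_def)
        then have "((\<lambda>y. f (2 ^ n * y)) \<longlongrightarrow> f (2 ^ n * x)) (at x)"
          by (simp add: continuous_on_eq_continuous_at isCont_def)
        then have "((\<lambda>y. d y n) \<longlongrightarrow> complex_of_real (f (2 ^ n * x) - E) - complex_of_real (f (2 ^ n * x) - E)) (at x)"
          unfolding d_def doubling_diag_def by (intro tendsto_intros)
        then show "((\<lambda>y. d y n) \<longlongrightarrow> 0) (at x)" by simp
      qed (use \<open>\<gamma> > 0\<close> in auto)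
      then have "((\<lambda>y. norm (diag (d y) (G x)) / \<gamma>) \<longlongrightarrow> 0) (at x)" by simp
      then have "((\<lambda>y. G y - G x) \<longlongrightarrow> 0) (at x)"
        by (rule Lim_null_comparison[OF always_eventually[OF allI[OF bound]]])
      then have "(G \<longlongrightarrow> G x) (at x)" by (rule LIM_zero_cancel)
      then show ?thesis
        unfolding isCont_def by (rule bounded_linear.tendsto[OF bounded_linear_coord])
    qed
    then show "continuous_on UNIV (\<lambda>x. coord (G x) n)" for n
      by (simp add: continuous_on_eq_continuous_at)
  qed
qed

section \<open>From the stable direction to a continuous angle\<close>

lemma sin_diff_eq_zero_of_proportional:
  fixes g0 g1 :: complex
  assumes "g0 * complex_of_real (cos \<theta>) = g1 * complex_of_real (sin \<theta>)"
    and "g0 * complex_of_real (cos \<theta>') = g1 * complex_of_real (sin \<theta>')" and "g0 \<noteq> 0 \<or> g1 \<noteq> 0"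
  shows "sin (\<theta>' - \<theta>) = 0"
proof -
  have "g0 * complex_of_real (sin (\<theta>' - \<theta>)) =
      (g0 * complex_of_real (cos \<theta>)) * complex_of_real (sin \<theta>')
      - (g0 * complex_of_real (cos \<theta>')) * complex_of_real (sin \<theta>)"
    by (simp add: sin_diff algebra_simps)
  also have "\<dots> = 0" unfolding assms(1,2) by simp
  finally have 0: "g0 * complex_of_real (sin (\<theta>' - \<theta>)) = 0" .
  have "g1 * complex_of_real (sin (\<theta>' - \<theta>)) =
      (g1 * complex_of_real (sin \<theta>')) * complex_of_real (cos \<theta>)
      - (g1 * complex_of_real (sin \<theta>)) * complex_of_real (cos \<theta>')"
    by (simp add: sin_diff algebra_simps)
  also have "\<dots> = 0" unfolding assms(1,2)[symmetric] by simp
  finally show ?thesis using 0 assms(3) by (simp del: of_real_eq_0_iff) (use of_real_eq_0_iff in blast)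
qed

text \<open>The pair is real up to a common phase, which cancels in \<open>p x / q x\<close>; this
  quotient is the exponential of 2 \<i> \<theta>. Being continuous and nowhere zero on the line, it
  has a continuous logarithm, and half the imaginary part is the angle.\<close>

lemma angle_of_real_direction:
  fixes g0 g1 :: "real \<Rightarrow> complex"
  assumes cont: "continuous_on UNIV g0" "continuous_on UNIV g1"
    and real: "\<And>x. g0 x * cnj (g1 x) = g1 x * cnj (g0 x)"
    and nz: "\<And>x. g0 x \<noteq> 0 \<or> g1 x \<noteq> 0"
  obtains \<theta> :: "real \<Rightarrow> real" where "continuous_on UNIV \<theta>"
    "\<And>x. g0 x * complex_of_real (cos (\<theta> x)) = g1 x * complex_of_real (sin (\<theta> x))"
proof -
  define p q where "p x = g1 x + \<i> * g0 x" and "q x = g1 x - \<i> * g0 x" for x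
  have norm_eq: "p x * cnj (p x) = q x * cnj (q x)" for x
    using real[of x] by (simp add: p_def q_def algebra_simps)
  have nz': "p x \<noteq> 0" "q x \<noteq> 0" for x
  proof -
    have "p x = 0 \<longleftrightarrow> q x = 0"
      using norm_eq[of x] by (metis complex_cnj_zero_iff mult_eq_0_iff)
    moreover have "g1 x = (p x + q x) / 2" "g0 x = (p x - q x) / (2 * \<i>)"
      by (simp_all add: p_def q_def)
    ultimately show "p x \<noteq> 0" "q x \<noteq> 0" using nz[of x] by auto
  qed
  have "continuous_on UNIV (\<lambda>x. p x / q x)"
    using nz' unfolding p_def q_def by (intro continuous_intros cont) auto
  then obtain h where h: "continuous_on UNIV h" "\<And>x. p x / q x = exp (h x)"
    using continuous_logarithm_on_contractible[of UNIV "\<lambda>x. p x / q x"] nz' contractible_UNIV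
    by (metis UNIV_I divide_eq_0_iff)
  define \<theta> where "\<theta> x = Im (h x) / 2" for x
  have "Re (h x) = 0" for x
  proof -
    have "cmod (p x) = cmod (q x)"
      using norm_eq[of x] unfolding complex_norm_square[symmetric]
      by (metis of_real_eq_iff norm_ge_zero power2_eq_iff_nonneg)
    then have "cmod (exp (h x)) = 1"
      using h(2)[of x, symmetric] nz'(2)[of x] by (simp add: norm_divide)
    then show ?thesis by simp
  qed
  then have h_eq: "h x = \<i> * complex_of_real (\<theta> x) + \<i> * complex_of_real (\<theta> x)" for x
    by (simp add: complex_eq_iff \<theta>_def)
  have "p x / q x = cis (\<theta> x) * cis (\<theta> x)" for x
    unfolding h(2) by (subst h_eq) (simp only: exp_add cis_conv_exp)
  then have "p x = q x * (cis (\<theta> x) * cis (\<theta> x))" for x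
    using nz'(2)[of x] by (metis nonzero_mult_div_cancel_left times_divide_eq_right)
  then have rot: "p x * cis (- \<theta> x) = q x * cis (\<theta> x)" for x
    by (simp add: mult.assoc cis_mult)
  have "g0 x * complex_of_real (cos (\<theta> x)) = g1 x * complex_of_real (sin (\<theta> x))" for x
  proof -
    have "cis (- \<theta> x) = complex_of_real (cos (\<theta> x)) - \<i> * complex_of_real (sin (\<theta> x))"
      "cis (\<theta> x) = complex_of_real (cos (\<theta> x)) + \<i> * complex_of_real (sin (\<theta> x))"
      by (simp_all add: complex_eq_iff)
    from rot[of x, unfolded this p_def q_def]
    have "2 * \<i> * (g0 x * complex_of_real (cos (\<theta> x)) - g1 x * complex_of_real (sin (\<theta> x))) = 0"
      by (simp add: algebra_simps)
    then show ?thesis by simp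
  qed
  moreover have "continuous_on UNIV \<theta>"
    unfolding \<theta>_def by (intro continuous_intros h) simp
  ultimately show ?thesis using that by blast
qed

lemma stable_angle_exists:
  assumes f: "circle_continuous f" and E: "E \<notin> approximate_spectrum f"
  obtains \<theta> :: "real \<Rightarrow> real" where "continuous_on UNIV \<theta>" "\<And>x. sin (\<theta> (x + 1) - \<theta> x) = 0"
    "\<And>x. cos (\<theta> x) * cos (\<theta> (2 * x)) = ((E - f (2 * x)) * cos (\<theta> x) - sin (\<theta> x)) * sin (\<theta> (2 * x))"
proof -
  obtain G where rec: "\<And>x n. coord (G x) (Suc (Suc n)) + coord (G x) n
        + complex_of_real (f (2 ^ Suc n * x) - E) * coord (G x) (Suc n) = 0"
    and nz: "\<And>x. coord (G x) 0 \<noteq> 0 \<or> coord (G x) 1 \<noteq> 0"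
    and per: "\<And>x. G (x + 1) = G x" and cont: "\<And>n. continuous_on UNIV (\<lambda>x. coord (G x) n)"
    using decaying_solution_exists[OF f E] by metis
  \<comment> \<open>The potential is real, so the conjugate sequence is a decaying solution too and
    must be proportional to the original.\<close>
  have real: "coord (G x) 0 * cnj (coord (G x) 1) = coord (G x) 1 * cnj (coord (G x) 0)" for x
  proof (rule decaying_solutions_proportional[where u = "coord (G x)" and v = "\<lambda>n. cnj (coord (G x) n)", OF coord_tendsto_zero _ rec])
    show "(\<lambda>n. cnj (coord (G x) n)) \<longlonglongrightarrow> 0"
      using tendsto_cnj[OF coord_tendsto_zero[of "G x"]] by simp
    show "cnj (coord (G x) (Suc (Suc n))) + cnj (coord (G x) n)
        + complex_of_real (f (2 ^ Suc n * x) - E) * cnj (coord (G x) (Suc n)) = 0" for n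
      using arg_cong[OF rec[of x n], of cnj] by simp
  qed
  obtain \<theta> where \<theta>: "continuous_on UNIV \<theta>"
    "\<And>x. coord (G x) 0 * complex_of_real (cos (\<theta> x)) = coord (G x) 1 * complex_of_real (sin (\<theta> x))"
    using angle_of_real_direction[OF cont cont real nz] by blast
  have polar: "\<exists>\<zeta>. \<zeta> \<noteq> 0 \<and> coord (G x) 0 = \<zeta> * complex_of_real (sin (\<theta> x)) \<and>
      coord (G x) 1 = \<zeta> * complex_of_real (cos (\<theta> x))" for x
  proof (cases "sin (\<theta> x) = 0")
    case True
    then have "cos (\<theta> x) \<noteq> 0" using sin_zero_abs_cos_one by fastforce
    then show ?thesis
      using True \<theta>(2)[of x] nz[of x] by (intro exI[of _ "coord (G x) 1 / complex_of_real (cos (\<theta> x))"]) auto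
  next
    case False
    then show ?thesis
      using \<theta>(2)[of x] nz[of x] by (intro exI[of _ "coord (G x) 0 / complex_of_real (sin (\<theta> x))"]) (auto simp: field_simps)
  qed
  show ?thesis
  proof (rule that[OF \<theta>(1)])
    show "sin (\<theta> (x + 1) - \<theta> x) = 0" for x
      using sin_diff_eq_zero_of_proportional[OF \<theta>(2)[of x] _ nz[of x], of "\<theta> (x + 1)"] \<theta>(2)[of "x + 1"]
      by (simp add: per)
    show "cos (\<theta> x) * cos (\<theta> (2 * x)) = ((E - f (2 * x)) * cos (\<theta> x) - sin (\<theta> x)) * sin (\<theta> (2 * x))" for x
    proof -
      \<comment> \<open>Dropping the first entry of the solution over \<open>x\<close> leaves a
        decaying solution over \<open>2 * x\<close>.\<close>
      have wronskian: "coord (G x) (Suc 0) * coord (G (2 * x)) 1 = coord (G x) (Suc 1) * coord (G (2 * x)) 0"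
      proof (rule decaying_solutions_proportional[where u = "\<lambda>n. coord (G x) (Suc n)" and v = "coord (G (2 * x))",
            OF LIMSEQ_Suc[OF coord_tendsto_zero] coord_tendsto_zero _ rec])
        show "coord (G x) (Suc (Suc (Suc n))) + coord (G x) (Suc n)
            + complex_of_real (f (2 ^ Suc n * (2 * x)) - E) * coord (G x) (Suc (Suc n)) = 0" for n
          using rec[of x "Suc n"] by (simp add: mult.assoc mult.left_commute)
      qed
      have step: "coord (G x) (Suc 1) = complex_of_real (E - f (2 * x)) * coord (G x) 1 - coord (G x) 0"
        using rec[of x 0] by (simp add: algebra_simps eq_neg_iff_add_eq_0)
      obtain \<zeta> where \<zeta>: "\<zeta> \<noteq> 0" "coord (G x) 0 = \<zeta> * complex_of_real (sin (\<theta> x))"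
        "coord (G x) 1 = \<zeta> * complex_of_real (cos (\<theta> x))"
        using polar by blast
      obtain \<zeta>' where \<zeta>': "\<zeta>' \<noteq> 0" "coord (G (2 * x)) 0 = \<zeta>' * complex_of_real (sin (\<theta> (2 * x)))"
        "coord (G (2 * x)) 1 = \<zeta>' * complex_of_real (cos (\<theta> (2 * x)))"
        using polar by blast
      have "coord (G x) 1 * coord (G (2 * x)) 1
          = (complex_of_real (E - f (2 * x)) * coord (G x) 1 - coord (G x) 0) * coord (G (2 * x)) 0"
        using wronskian unfolding step by simp
      then have "(\<zeta> * \<zeta>') * complex_of_real (cos (\<theta> x) * cos (\<theta> (2 * x)))
          = (\<zeta> * \<zeta>') * complex_of_real (((E - f (2 * x)) * cos (\<theta> x) - sin (\<theta> x)) * sin (\<theta> (2 * x)))"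
        unfolding \<zeta>(2,3) \<zeta>'(2,3) by (simp add: algebra_simps)
      then show ?thesis
        using \<open>\<zeta> \<noteq> 0\<close> \<open>\<zeta>' \<noteq> 0\<close> by (simp only: mult_cancel_left of_real_eq_iff) simp
    qed
  qed
qed

section \<open>Degree and the action of transfer matrices on angles\<close>

lemma continuous_int_valued_constant:
  fixes h :: "real \<Rightarrow> real"
  assumes "continuous_on UNIV h" and int: "\<And>x. h x \<in> \<int>"
  obtains k :: int where "\<And>x. h x = real_of_int k"
proof -
  have "h constant_on UNIV"
  proof (rule continuous_discrete_range_constant[OF connected_UNIV assms(1)])
    fix x
    have "1 \<le> norm (h y - h x)" if "h y \<noteq> h x" for y
    proof -
      obtain m n :: int where "h x = real_of_int m" "h y = real_of_int n"
        using int by (metis Ints_cases)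
      then show ?thesis using that by (simp flip: of_int_diff of_int_abs)
    qed
    then show "\<exists>e>0. \<forall>y. y \<in> UNIV \<and> h y \<noteq> h x \<longrightarrow> e \<le> norm (h y - h x)"
      by (intro exI[of _ 1]) auto
  qed
  then obtain c where c: "\<And>x. h x = c" by (auto simp: constant_on_def)
  moreover obtain k :: int where "c = real_of_int k"
    using int[of 0] c[of 0] by (metis Ints_cases)
  ultimately show ?thesis using that by blast
qed

text \<open>The factor \<open>1 - t cos \<phi> sin \<phi> - \<i> t cos\<^sup>2 \<phi>\<close> is the ratio of the vectors
  \<open>(t cos \<phi> - sin \<phi>, cos \<phi>)\<close> and \<open>(- sin \<phi>, cos \<phi>)\<close>. It avoids the negative real axis, because
  the shear taking the second vector to the first one fixes the horizontal axis.\<close>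

definition shear_angle :: "real \<Rightarrow> real \<Rightarrow> real" where
  "shear_angle t \<phi> = Im (Ln (Complex (1 - t * (cos \<phi> * sin \<phi>)) (- t * (cos \<phi>)\<^sup>2)))"

lemma shear_ratio_not_nonpos: "Complex (1 - t * (cos \<phi> * sin \<phi>)) (- t * (cos \<phi>)\<^sup>2) \<notin> \<real>\<^sub>\<le>\<^sub>0"
  by (auto simp: complex_nonpos_Reals_iff)

text \<open>In the complex plane \<open>(- sin \<phi>, cos \<phi>)\<close> has argument
  \<open>\<phi> + pi / 2\<close>; multiplication by the ratio turns it by
  \<open>shear_angle t \<phi>\<close> and stretches it by the modulus \<rho>.\<close>

lemma shear_angle:
  obtains \<rho> where "\<rho> > 0" "\<rho> * cos (\<phi> + pi / 2 + shear_angle t \<phi>) = t * cos \<phi> - sin \<phi>"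
    "\<rho> * sin (\<phi> + pi / 2 + shear_angle t \<phi>) = cos \<phi>"
proof -
  define Q where "Q = Complex (1 - t * (cos \<phi> * sin \<phi>)) (- t * (cos \<phi>)\<^sup>2)"
  define \<delta> where "\<delta> = shear_angle t \<phi>"
  have "Q \<noteq> 0" using shear_ratio_not_nonpos[of t \<phi>] by (auto simp: Q_def)
  then have "Q = exp (Ln Q)" by simp
  also have "Ln Q = complex_of_real (ln (cmod Q)) + \<i> * complex_of_real \<delta>"
    using \<open>Q \<noteq> 0\<close> by (simp add: complex_eq_iff \<delta>_def shear_angle_def Q_def)
  also have "exp \<dots> = complex_of_real (cmod Q) * cis \<delta>"
    using \<open>Q \<noteq> 0\<close> by (simp add: exp_add cis_conv_exp exp_of_real)
  finally have "Complex (cmod Q * cos \<delta>) (cmod Q * sin \<delta>) = Q"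
    by (simp add: complex_eq_iff)
  then have Q: "cmod Q * cos \<delta> = 1 - t * (cos \<phi> * sin \<phi>)" "cmod Q * sin \<delta> = - t * (cos \<phi>)\<^sup>2"
    by (simp_all add: Q_def complex_eq_iff)
  have sq: "sin \<phi> * sin \<phi> = 1 - cos \<phi> * cos \<phi>"
    using sin_squared_eq[of \<phi>] by (simp only: power2_eq_square)
  have "cmod Q * cos (\<phi> + pi / 2 + \<delta>)
      = - (cmod Q * cos \<delta>) * sin \<phi> - (cmod Q * sin \<delta>) * cos \<phi>"
    by (simp add: cos_add sin_add algebra_simps)
  also have "\<dots> = t * cos \<phi> * (sin \<phi> * sin \<phi>) + t * cos \<phi> * (cos \<phi> * cos \<phi>) - sin \<phi>"
    unfolding Q by (simp add: power2_eq_square algebra_simps)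
  also have "\<dots> = t * cos \<phi> - sin \<phi>" unfolding sq by (simp add: algebra_simps)
  finally have 1: "cmod Q * cos (\<phi> + pi / 2 + \<delta>) = t * cos \<phi> - sin \<phi>" .
  have "cmod Q * sin (\<phi> + pi / 2 + \<delta>)
      = (cmod Q * cos \<delta>) * cos \<phi> - (cmod Q * sin \<delta>) * sin \<phi>"
    by (simp add: cos_add sin_add algebra_simps)
  also have "\<dots> = cos \<phi>"
    unfolding Q by (simp add: power2_eq_square algebra_simps)
  finally show ?thesis
    using that[of "cmod Q"] 1 \<open>Q \<noteq> 0\<close> by (simp add: \<delta>_def)
qed

lemma shear_angle_bounds: "- pi < shear_angle t \<phi>" "shear_angle t \<phi> \<le> pi"
proof -
  have "Complex (1 - t * (cos \<phi> * sin \<phi>)) (- t * (cos \<phi>)\<^sup>2) \<noteq> 0"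
    using shear_ratio_not_nonpos[of t \<phi>] by (metis nonpos_Reals_zero_I)
  then show "- pi < shear_angle t \<phi>" "shear_angle t \<phi> \<le> pi"
    using mpi_less_Im_Ln Im_Ln_le_pi by (auto simp: shear_angle_def)
qed

lemma continuous_on_shear_angle:
  fixes t \<phi> :: "real \<Rightarrow> real"
  assumes "continuous_on UNIV t" and "continuous_on UNIV \<phi>"
  shows "continuous_on UNIV (\<lambda>x. shear_angle (t x) (\<phi> x))"
proof -
  have "continuous_on UNIV (\<lambda>x. Complex (1 - t x * (cos (\<phi> x) * sin (\<phi> x))) (- t x * (cos (\<phi> x))\<^sup>2))"
    unfolding Complex_eq by (intro continuous_intros assms)
  then show ?thesis
    unfolding shear_angle_def
    by (intro continuous_on_Im continuous_on_Ln' shear_ratio_not_nonpos)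
qed

text \<open>The shear keeps the second coordinate and hence both open half planes; as it turns by at
  most \<open>pi\<close>, the angle cannot leave its interval between consecutive multiples of
  \<open>pi\<close>. This makes the integer parts of angles predictable.\<close>

lemma shear_angle_cell:
  fixes j :: int
  assumes "real_of_int j * pi - pi / 2 < \<phi>" "\<phi> < real_of_int j * pi + pi / 2"
  shows "real_of_int j * pi < \<phi> + pi / 2 + shear_angle t \<phi>"
    "\<phi> + pi / 2 + shear_angle t \<phi> < (real_of_int j + 1) * pi"
proof -
  define \<alpha> where "\<alpha> = \<phi> + pi / 2 - real_of_int j * pi"
  define \<delta> where "\<delta> = shear_angle t \<phi>"
  have \<alpha>: "0 < \<alpha>" "\<alpha> < pi" using assms by (simp_all add: \<alpha>_def)
  have \<delta>: "- pi < \<delta>" "\<delta> \<le> pi" using shear_angle_bounds by (simp_all add: \<delta>_def)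
  obtain \<rho> where \<rho>: "\<rho> > 0" "\<rho> * sin (\<phi> + pi / 2 + \<delta>) = cos \<phi>"
    using shear_angle[of \<phi> t] unfolding \<delta>_def by blast
  define s where "s = cos (real_of_int j * pi)"
  have sj: "sin (real_of_int j * pi) = 0" by (simp add: sin_zero_iff_int2)
  then have s: "s * s = 1"
    using sin_cos_squared_add[of "real_of_int j * pi"] by (simp add: s_def power2_eq_square)
  have shift: "sin (x - real_of_int j * pi) = s * sin x" for x
    by (simp add: sin_diff sj s_def)
  have "\<rho> * sin (\<alpha> + \<delta>) = s * (\<rho> * sin (\<phi> + pi / 2 + \<delta>))"
    using shift[of "\<phi> + pi / 2 + \<delta>"] by (simp add: \<alpha>_def algebra_simps)
  also have "\<dots> = s * sin (\<phi> + pi / 2)" unfolding \<rho>(2) by (simp add: sin_add)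
  also have "\<dots> = sin \<alpha>" unfolding \<alpha>_def shift ..
  finally have "\<rho> * sin (\<alpha> + \<delta>) > 0" using sin_gt_zero[OF \<alpha>] by simp
  then have pos: "sin (\<alpha> + \<delta>) > 0" using \<rho>(1) by (simp add: zero_less_mult_iff)
  have "0 < \<alpha> + \<delta>"
  proof (rule ccontr)
    assume "\<not> 0 < \<alpha> + \<delta>"
    then have "sin (- (\<alpha> + \<delta>)) \<ge> 0" using \<alpha> \<delta> by (intro sin_ge_zero) auto
    then show False using pos unfolding sin_minus by linarith
  qed
  moreover have "\<alpha> + \<delta> < pi"
  proof (rule ccontr)
    assume "\<not> \<alpha> + \<delta> < pi"
    then have "sin (\<alpha> + \<delta>) \<le> 0" using \<alpha> \<delta> by (intro sin_le_zero) auto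
    then show False using pos by simp
  qed
  ultimately show "real_of_int j * pi < \<phi> + pi / 2 + shear_angle t \<phi>"
    "\<phi> + pi / 2 + shear_angle t \<phi> < (real_of_int j + 1) * pi"
    by (simp_all add: \<alpha>_def \<delta>_def algebra_simps)
qed

lemma shear_angle_zero: "cos \<phi> = 0 \<Longrightarrow> shear_angle t \<phi> = 0"
  by (simp add: shear_angle_def flip: one_complex.code)

text \<open>Cosine and sine enter only through products of two of them, so the common sign by which
  the two angles differ cancels.\<close>

lemma shear_angle_periodic:
  assumes "sin (\<phi>' - \<phi>) = 0"
  shows "shear_angle t \<phi>' = shear_angle t \<phi>"
proof -
  define s where "s = cos (\<phi>' - \<phi>)"
  have s: "s * s = 1"
    using sin_cos_squared_add[of "\<phi>' - \<phi>"] assms by (simp add: s_def power2_eq_square)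
  have "cos \<phi>' = s * cos \<phi>" "sin \<phi>' = s * sin \<phi>"
    using cos_add[of \<phi> "\<phi>' - \<phi>"] sin_add[of \<phi> "\<phi>' - \<phi>"] assms by (simp_all add: s_def)
  moreover have "(s * x) * (s * y) = x * y" for x y
    using s by (metis mult.assoc mult.left_commute mult_1)
  ultimately have "cos \<phi>' * sin \<phi>' = cos \<phi> * sin \<phi>" "(cos \<phi>')\<^sup>2 = (cos \<phi>)\<^sup>2"
    by (simp_all only: power2_eq_square)
  then show ?thesis by (simp only: shear_angle_def)
qed

text \<open>Doubling the angle variable doubles the degree \<open>d\<close> of the stable direction, whereas the cocycle
  is homotopic to a constant and preserves it. Hence \<open>2 d = d\<close>, and the angle is periodic.\<close>

lemma stable_angle_periodic:
  assumes f: "circle_continuous f" and E: "E \<notin> approximate_spectrum f"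
  obtains \<theta> k where "circle_continuous \<theta>"
    "\<And>x. \<theta> (2 * x) = \<theta> x + pi / 2 + shear_angle (E - f (2 * x)) (\<theta> x) + real_of_int k * pi"
    "\<And>x. cos (\<theta> x) * cos (\<theta> (2 * x)) = ((E - f (2 * x)) * cos (\<theta> x) - sin (\<theta> x)) * sin (\<theta> (2 * x))"
proof -
  obtain \<theta> where cont: "continuous_on UNIV \<theta>" and shift: "\<And>x. sin (\<theta> (x + 1) - \<theta> x) = 0"
    and step: "\<And>x. cos (\<theta> x) * cos (\<theta> (2 * x)) = ((E - f (2 * x)) * cos (\<theta> x) - sin (\<theta> x)) * sin (\<theta> (2 * x))"
    using stable_angle_exists[OF f E] by blast
  define \<delta> where "\<delta> x = shear_angle (E - f (2 * x)) (\<theta> x)" for x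
  have contf: "continuous_on UNIV (\<lambda>x. E - f (2 * x))"
    using f by (intro continuous_intros continuous_on_compose2[of UNIV f UNIV "\<lambda>x. 2 * x"])
      (auto simp: circle_continuous_def)
  have cont\<delta>: "continuous_on UNIV \<delta>"
    unfolding \<delta>_def by (rule continuous_on_shear_angle[OF contf cont])
  have cont_compose: "continuous_on UNIV (\<lambda>x. \<theta> (a * x + b))" for a b
    by (rule continuous_on_compose2[OF cont]) (auto intro!: continuous_intros)
  have int: "y / pi \<in> \<int>" if "sin y = 0" for y
    using that by (auto simp: sin_zero_iff_int2)
  have "continuous_on UNIV (\<lambda>x. (\<theta> (x + 1) - \<theta> x) / pi)"
    using cont_compose[of 1 1] by (intro continuous_intros cont) auto
  then obtain d where d: "\<And>x. (\<theta> (x + 1) - \<theta> x) / pi = real_of_int d"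
    using continuous_int_valued_constant int[OF shift] by blast
  \<comment> \<open>Both angles describe the stable direction at \<open>2 * x\<close>, so they
    differ by a multiple of \<open>pi\<close>, the same for all \<open>x\<close> by
    continuity.\<close>
  have "sin (\<theta> (2 * x) - (\<theta> x + pi / 2 + \<delta> x)) = 0" for x
  proof -
    obtain \<rho> where \<rho>: "\<rho> > 0" "\<rho> * cos (\<theta> x + pi / 2 + \<delta> x) = (E - f (2 * x)) * cos (\<theta> x) - sin (\<theta> x)"
      "\<rho> * sin (\<theta> x + pi / 2 + \<delta> x) = cos (\<theta> x)"
      using shear_angle[of "\<theta> x" "E - f (2 * x)"] unfolding \<delta>_def by blast
    have "\<rho> * sin (\<theta> (2 * x) - (\<theta> x + pi / 2 + \<delta> x))
        = (\<rho> * cos (\<theta> x + pi / 2 + \<delta> x)) * sin (\<theta> (2 * x))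
          - (\<rho> * sin (\<theta> x + pi / 2 + \<delta> x)) * cos (\<theta> (2 * x))"
      by (simp only: sin_diff) (simp add: algebra_simps)
    also have "\<dots> = 0" unfolding \<rho>(2,3) step by simp
    finally show ?thesis using \<rho>(1) by simp
  qed
  note int_step = int[OF this]
  have "continuous_on UNIV (\<lambda>x. (\<theta> (2 * x) - (\<theta> x + pi / 2 + \<delta> x)) / pi)"
    using cont_compose[of 2 0] by (intro continuous_intros cont cont\<delta>) auto
  then obtain k where k: "\<And>x. (\<theta> (2 * x) - (\<theta> x + pi / 2 + \<delta> x)) / pi = real_of_int k"
    using continuous_int_valued_constant int_step by blast
  have d': "\<theta> (x + 1) = \<theta> x + real_of_int d * pi" for x
    using d[of x] by (simp add: field_simps)
  have k': "\<theta> (2 * x) = \<theta> x + pi / 2 + \<delta> x + real_of_int k * pi" for x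
    using k[of x] by (simp add: field_simps)
  have "\<delta> 1 = \<delta> 0"
  proof -
    have "f (2 * 1) = f (2 * 0)"
      using circle_continuous_shift_int[OF f, of 0 2] by simp
    then show ?thesis
      using shear_angle_periodic[OF shift[of 0]] by (simp add: \<delta>_def)
  qed
  \<comment> \<open>From 0 to 2 the angle gains two periods' worth, whereas the recursion compared
    at 0 and 1 allows only one, \<delta> being equal there.\<close>
  moreover have "\<theta> 2 = \<theta> 0 + 2 * (real_of_int d * pi)"
    using d'[of 0] d'[of 1] by simp
  ultimately have "real_of_int d * pi = 0"
    using k'[of 0] k'[of 1] d'[of 0] by simp
  then have "circle_continuous \<theta>"
    using cont d' by (simp add: circle_continuous_def)
  then show ?thesis using that k' step unfolding \<delta>_def by blast
qed

section \<open>Integer parts of a bounded angle sequence\<close>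

lemma bounded_monotone_int_eventually_constant:
  fixes i :: "nat \<Rightarrow> int"
  assumes mono: "\<And>n. i n \<le> i (Suc n)" and bound: "\<And>n. i n \<le> M"
  obtains N where "\<And>n. n \<ge> N \<Longrightarrow> i n = i N"
proof -
  have mono': "i m \<le> i n" if "m \<le> n" for m n
    by (rule lift_Suc_mono_le[of i, OF mono that])
  have "finite (range i)"
    by (rule finite_subset[of _ "{i 0..M}"]) (use mono'[of 0] bound in auto)
  then have "Max (range i) \<in> range i" by (intro Max_in) auto
  then obtain N where N: "i N = Max (range i)" by auto
  have "i n = i N" if "n \<ge> N" for n
    using Max_ge[OF \<open>finite (range i)\<close>, of "i n"] mono'[OF that] N by auto
  then show ?thesis by (rule that)
qed

text \<open>Angles are measured in multiples of \<open>\<pi>\<close>. Boundedness forces \<open>k = 0\<close> or \<open>k = - 1\<close>, and then the floors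
  are eventually constant.\<close>

lemma bounded_angles_eventually_in_quadrant:
  fixes p :: "nat \<Rightarrow> real" and k :: int
  assumes bounded: "bounded (range p)"
    and step: "\<And>n. \<lfloor>p (Suc n)\<rfloor> = \<lfloor>p n + 1/2\<rfloor> + k"
    and edge: "\<And>n. p (Suc n) \<in> \<int> \<longleftrightarrow> p n + 1/2 \<in> \<int>"
  obtains N where "\<And>n. n \<ge> N \<Longrightarrow> 0 < frac (p n) \<and> frac (p n) < 1/2"
    | N where "\<And>n. n \<ge> N \<Longrightarrow> 1/2 < frac (p n)"
proof -
  obtain C where C: "\<And>n. \<bar>p n\<bar> \<le> C" using bounded by (auto simp: bounded_iff)
  have bound: "\<lfloor>p n\<rfloor> \<le> \<lceil>C\<rceil>" "- \<lfloor>p n\<rfloor> \<le> \<lceil>C\<rceil> + 1" for n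
    using C[of n] by linarith+
  have half: "\<lfloor>p n\<rfloor> \<le> \<lfloor>p n + 1/2\<rfloor>" "\<lfloor>p n + 1/2\<rfloor> \<le> \<lfloor>p n\<rfloor> + 1" for n
    by linarith+
  have not_edge: "frac (p (Suc n)) \<noteq> 0" if "frac (p n) \<noteq> 1/2" for n
  proof
    assume "frac (p (Suc n)) = 0"
    then have "p n + 1/2 \<in> \<int>" using edge by simp
    then obtain m where m: "p n + 1/2 = real_of_int m" by (auto elim: Ints_cases)
    then have "p n = real_of_int (m - 1) + 1/2" by simp
    then have "frac (p n) = frac (1/2)" by (simp only: frac_add_of_int_left)
    also have "frac (1/2::real) = 1/2" by (simp add: frac_eq)
    finally show False using that by simp
  qed
  show ?thesis
  proof (cases "k \<ge> 0")
    case True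
    have "\<lfloor>p n\<rfloor> \<le> \<lfloor>p (Suc n)\<rfloor>" for n using step[of n] half[of n] True by linarith
    then obtain N where N: "\<And>n. n \<ge> N \<Longrightarrow> \<lfloor>p n\<rfloor> = \<lfloor>p N\<rfloor>"
      using bounded_monotone_int_eventually_constant[of "\<lambda>n. \<lfloor>p n\<rfloor>" "\<lceil>C\<rceil>"] bound(1) by blast
    \<comment> \<open>With \<open>k \<ge> 0\<close>, constant floors leave no room for rounding
      up.\<close>
    have small: "frac (p n) < 1/2" if "n \<ge> N" for n
    proof -
      have "\<lfloor>p n + 1/2\<rfloor> = \<lfloor>p n\<rfloor>"
        using N[of n] N[of "Suc n"] that step[of n] half[of n] True by linarith
      then show ?thesis unfolding frac_def by linarith
    qed
    \<comment> \<open>One more index is dropped: the value 0 is excluded through the predecessor,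
      whose fractional part would have to be 1/2.\<close>
    have "0 < frac (p n) \<and> frac (p n) < 1/2" if "n \<ge> Suc N" for n
    proof -
      obtain m where m: "n = Suc m" "m \<ge> N" using \<open>n \<ge> Suc N\<close> by (metis Suc_le_D Suc_le_mono)
      then show ?thesis
        using small[of n] not_edge[of m] small[OF m(2)] frac_ge_0[of "p n"] by (auto simp: less_le)
    qed
    then show ?thesis using that(1) by blast
  next
    case False
    have "- \<lfloor>p n\<rfloor> \<le> - \<lfloor>p (Suc n)\<rfloor>" for n using step[of n] half[of n] False by linarith
    then obtain N where N: "\<And>n. n \<ge> N \<Longrightarrow> - \<lfloor>p n\<rfloor> = - \<lfloor>p N\<rfloor>"
      using bounded_monotone_int_eventually_constant[of "\<lambda>n. - \<lfloor>p n\<rfloor>" "\<lceil>C\<rceil> + 1"] bound(2) by blast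
    have large: "frac (p n) \<ge> 1/2" if "n \<ge> N" for n
    proof -
      have "\<lfloor>p n + 1/2\<rfloor> = \<lfloor>p n\<rfloor> + 1"
        using N[of n] N[of "Suc n"] that step[of n] half[of n] False by linarith
      then show ?thesis unfolding frac_def by linarith
    qed
    \<comment> \<open>Here the value 1/2 is excluded through the successor, which would be an
      integer.\<close>
    have "1/2 < frac (p n)" if "n \<ge> N" for n
    proof (rule ccontr)
      assume "\<not> 1/2 < frac (p n)"
      then have "frac (p n) = 1/2" using large[OF that] by simp
      then have "p n + 1/2 = real_of_int (\<lfloor>p n\<rfloor> + 1)" by (simp add: frac_def)
      then have "frac (p (Suc n)) = 0" using edge[of n] by simp
      moreover have "Suc n \<ge> N" using that by simp
      ultimately show False using large[of "Suc n"] by linarith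
    qed
    then show ?thesis using that(2) by blast
  qed
qed


section \<open>Absence of gaps\<close>

text \<open>Positivity of a solution quotient makes the operator a sum of squares (Jacobi's factorization);
  \<open>r n\<close> plays the role of \<open>u (n + 1) / u n\<close> for a solution \<open>u\<close>.\<close>

lemma inner_jacobi_factorization:
  fixes r v :: "nat \<Rightarrow> real"
  assumes b: "bounded (range (\<lambda>n. complex_of_real (v n)))"
    and r: "\<And>n. r n \<noteq> 0" "\<And>n. r (Suc n) + 1 / r n = - v (Suc n)"
    and \<psi>: "coord \<psi> 0 = 0" "\<And>n. n > L \<Longrightarrow> coord \<psi> n = 0"
  shows "inner (jacobi (\<lambda>n. complex_of_real (v n)) \<psi>) \<psi> =
    - (\<Sum>n\<le>L. 1 / r n * (cmod (coord \<psi> (Suc n) - complex_of_real (r n) * coord \<psi> n))\<^sup>2)"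
proof -
  define q x where "q n = (cmod (coord \<psi> n))\<^sup>2" and "x n = Re (coord \<psi> (Suc n) * cnj (coord \<psi> n))" for n
  define T where "T n = Re (coord (jacobi (\<lambda>n. complex_of_real (v n)) \<psi>) n * cnj (coord \<psi> n))" for n
  have T0: "T 0 = 0" by (simp add: T_def \<psi>)
  have T: "T (Suc n) = x (Suc n) + x n + v (Suc n) * q (Suc n)" for n
    unfolding T_def coord_jacobi[OF b] q_def x_def cmod_power2
    by (simp add: power2_eq_square algebra_simps)
  define D where "D n = 1 / r n * (cmod (coord \<psi> (Suc n) - complex_of_real (r n) * coord \<psi> n))\<^sup>2" for n
  have D: "D n = q (Suc n) / r n - 2 * x n + r n * q n" for n
  proof -
    have "(cmod (coord \<psi> (Suc n) - complex_of_real (r n) * coord \<psi> n))\<^sup>2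
        = q (Suc n) - 2 * r n * x n + (r n)\<^sup>2 * q n"
      unfolding q_def x_def cmod_power2 by (simp add: power2_eq_square algebra_simps)
    then show ?thesis
      using r(1)[of n] by (simp add: D_def field_simps power2_eq_square)
  qed
  \<comment> \<open>By the recursion for \<open>r\<close>, each row splits into a multiple of a
    square and a telescoping remainder.\<close>
  have sum: "(\<Sum>n\<le>M. T n) = x M - r M * q M - (\<Sum>n<M. D n)" for M
  proof (induction M)
    case 0
    show ?case by (simp add: T0 x_def q_def \<psi>)
  next
    case (Suc M)
    have v: "v (Suc M) = - r (Suc M) - 1 / r M" using r(2)[of M] by simp
    show ?case
      unfolding sum.atMost_Suc sum.lessThan_Suc Suc T D[of M] v by (simp add: algebra_simps)
  qed
  \<comment> \<open>Summing to \<open>Suc L\<close>, one beyond the support, makes the boundary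
    terms vanish and includes the square at \<open>L\<close>.\<close>
  have "T sums (\<Sum>n\<le>Suc L. T n)"
    by (rule sums_finite) (auto simp: T_def \<psi>)
  then have "inner (jacobi (\<lambda>n. complex_of_real (v n)) \<psi>) \<psi> = (\<Sum>n\<le>Suc L. T n)"
    using sums_unique2[OF inner_ell2_sums] unfolding T_def by blast
  then show ?thesis
    unfolding sum by (simp add: x_def q_def D_def \<psi> lessThan_Suc_atMost)
qed

text \<open>From \<open>N\<close> on, the factorization makes \<open>s\<close> times the form of the
  operator minus \<open>E\<close> nonpositive; an approximate eigenvector for \<open>b\<close>
  placed there has form close to \<open>b - E\<close>.\<close>

lemma approximate_spectrum_on_one_side:
  assumes f: "circle_continuous f" and \<omega>: "dense_orbit \<omega>"
    and b: "b \<in> approximate_spectrum f" and s: "s = 1 \<or> s = - 1"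
    and r: "\<And>n. n \<ge> N \<Longrightarrow> 0 < s * r n"
      "\<And>n. n \<ge> N \<Longrightarrow> r (Suc n) + 1 / r n = E - f (2 ^ Suc n * \<omega>)"
  shows "s * b \<le> s * E"
proof (rule ccontr)
  assume "\<not> s * b \<le> s * E"
  then have pos: "s * (b - E) > 0" by (simp add: algebra_simps)
  obtain m \<psi> L where \<psi>: "m \<ge> N" "coord \<psi> 0 = 0" "\<And>n. n > L \<Longrightarrow> coord \<psi> n = 0" "norm \<psi> = 1"
    and small: "norm (jacobi (doubling_diag f b (2 ^ m * \<omega>)) \<psi>) < s * (b - E)"
    using approximate_spectrum_dense_orbit[OF f \<omega> b pos] by metis
  define y where "y = 2 ^ m * \<omega>"
  define v where "v n = f (2 ^ n * y) - E" for n
  have v: "(\<lambda>n. complex_of_real (v n)) = doubling_diag f E y"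
    by (simp add: v_def doubling_diag_def fun_eq_iff)
  have "inner (jacobi (\<lambda>n. complex_of_real (v n)) \<psi>) \<psi>
      = - (\<Sum>n\<le>L. 1 / r (m + n) * (cmod (coord \<psi> (Suc n) - complex_of_real (r (m + n)) * coord \<psi> n))\<^sup>2)"
  proof (rule inner_jacobi_factorization)
    show "bounded (range (\<lambda>n. complex_of_real (v n)))"
      unfolding v by (rule bounded_doubling_diag[OF f])
    show "r (m + n) \<noteq> 0" for n
      using r(1)[of "m + n"] \<psi>(1) by auto
    show "r (m + Suc n) + 1 / r (m + n) = - v (Suc n)" for n
      using r(2)[of "m + n"] \<psi>(1) by (simp add: v_def y_def power_add mult_ac)
  qed (use \<psi> in auto)
  then have "s * inner (jacobi (doubling_diag f E y) \<psi>) \<psi>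
      = - (\<Sum>n\<le>L. s / r (m + n) * (cmod (coord \<psi> (Suc n) - complex_of_real (r (m + n)) * coord \<psi> n))\<^sup>2)"
    unfolding v by (simp add: sum_distrib_left)
  moreover have "0 \<le> s / r (m + n)" for n
    using r(1)[of "m + n"] \<psi>(1) by (simp add: zero_le_divide_iff zero_less_mult_iff) auto
  then have "0 \<le> (\<Sum>n\<le>L. s / r (m + n) * (cmod (coord \<psi> (Suc n) - complex_of_real (r (m + n)) * coord \<psi> n))\<^sup>2)"
    by (intro sum_nonneg mult_nonneg_nonneg) auto
  ultimately have form: "s * inner (jacobi (doubling_diag f E y) \<psi>) \<psi> \<le> 0"
    by linarith
  have "jacobi (doubling_diag f b y) \<psi> = jacobi (doubling_diag f E y) \<psi> - (b - E) *\<^sub>R \<psi>"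
    by (rule ell2_eqI) (simp add: coord_jacobi[OF bounded_doubling_diag[OF f]] doubling_diag_def algebra_simps)
  then have "inner (jacobi (doubling_diag f b y) \<psi>) \<psi>
      = inner (jacobi (doubling_diag f E y) \<psi>) \<psi> - (b - E)"
    using \<psi>(4) by (simp only: inner_diff_left inner_scaleR_left dot_square_norm) simp
  then have "s * inner (jacobi (doubling_diag f b y) \<psi>) \<psi>
      = s * inner (jacobi (doubling_diag f E y) \<psi>) \<psi> - s * (b - E)"
    by (simp only: right_diff_distrib)
  then have "s * (b - E) \<le> \<bar>s * inner (jacobi (doubling_diag f b y) \<psi>) \<psi>\<bar>"
    using form by linarith
  also have "\<dots> = \<bar>inner (jacobi (doubling_diag f b y) \<psi>) \<psi>\<bar>"
    using s by auto
  also have "\<dots> \<le> norm (jacobi (doubling_diag f b y) \<psi>)"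
    using Cauchy_Schwarz_ineq2[of "jacobi (doubling_diag f b y) \<psi>" \<psi>] \<psi>(4) by simp
  finally show False using small by (simp add: y_def)
qed

text \<open>For the sign of the cotangent, which is that of \<open>sin (2 * \<theta>)\<close> and
  depends only on the half of a period of length \<open>pi\<close> that contains \<theta>.\<close>

lemma sin_times_cos_frac: "2 * (sin \<theta> * cos \<theta>) = sin (2 * pi * frac (\<theta> / pi))"
proof -
  have "2 * \<theta> = 2 * pi * frac (\<theta> / pi) + 2 * pi * real_of_int \<lfloor>\<theta> / pi\<rfloor>"
    by (simp add: frac_def algebra_simps)
  then have "sin (2 * \<theta>) = sin (2 * pi * frac (\<theta> / pi) + 2 * pi * real_of_int \<lfloor>\<theta> / pi\<rfloor>)"
    by simp
  also have "\<dots> = sin (2 * pi * frac (\<theta> / pi))"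
    by (simp add: sin_add sin_int_2pin cos_int_2pin)
  finally show ?thesis by (simp add: sin_double mult.assoc)
qed

lemma approximate_spectrum_no_gap:
  assumes f: "circle_continuous f" and E: "E \<notin> approximate_spectrum f"
    and a: "a \<in> approximate_spectrum f" and b: "b \<in> approximate_spectrum f"
    and "a < E" and "E < b"
  shows False
proof -
  obtain \<theta> k where \<theta>: "circle_continuous \<theta>"
    and lift: "\<And>x. \<theta> (2 * x) = \<theta> x + pi / 2 + shear_angle (E - f (2 * x)) (\<theta> x) + real_of_int k * pi"
    and step: "\<And>x. cos (\<theta> x) * cos (\<theta> (2 * x))
        = ((E - f (2 * x)) * cos (\<theta> x) - sin (\<theta> x)) * sin (\<theta> (2 * x))"
    using stable_angle_periodic[OF f E] by metis
  obtain \<omega> where \<omega>: "dense_orbit \<omega>" using ex_dense_orbit by blast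
  define p where "p n = \<theta> (2 ^ n * \<omega>) / pi" for n
  have Suc_orbit: "2 ^ Suc n * \<omega> = 2 * (2 ^ n * \<omega>)" for n by simp
  have p: "\<lfloor>p (Suc n)\<rfloor> = \<lfloor>p n + 1/2\<rfloor> + k \<and> (p (Suc n) \<in> \<int> \<longleftrightarrow> p n + 1/2 \<in> \<int>)" for n
  proof -
    define \<phi> t j where "\<phi> = \<theta> (2 ^ n * \<omega>)" and "t = E - f (2 ^ Suc n * \<omega>)" and "j = \<lfloor>p n + 1/2\<rfloor>"
    define p' where "p' = (\<phi> + pi / 2 + shear_angle t \<phi>) / pi"
    have "\<theta> (2 ^ Suc n * \<omega>) = \<phi> + pi / 2 + shear_angle t \<phi> + real_of_int k * pi"
      using lift[of "2 ^ n * \<omega>"] unfolding Suc_orbit \<phi>_def t_def .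
    then have p_Suc: "p (Suc n) = p' + real_of_int k"
      by (simp only: p_def p'_def) (simp add: field_simps)
    have \<phi>: "\<phi> = p n * pi" by (simp add: p_def \<phi>_def)
    have j: "real_of_int j \<le> p n + 1/2" "p n + 1/2 < real_of_int j + 1"
      unfolding j_def by linarith+
    \<comment> \<open>At an edge the cosine vanishes, the shear does not turn the vector, and the
      next angle is an exact multiple of \<open>pi\<close>; elsewhere the cell bounds apply.\<close>
    show ?thesis
    proof (cases "p n + 1/2 = real_of_int j")
      case True
      then have \<phi>_edge: "\<phi> = real_of_int j * pi - pi / 2"
        by (simp add: \<phi> algebra_simps flip: True)
      then have "cos \<phi> = 0" by (simp add: cos_diff sin_zero_iff_int2)
      from shear_angle_zero[OF this] have "p' = real_of_int j"
        using \<phi>_edge by (simp add: p'_def)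
      then show ?thesis
        using True by (simp add: p_Suc)
    next
      case False
      have "real_of_int j * pi - pi / 2 < \<phi>" "\<phi> < real_of_int j * pi + pi / 2"
      proof -
        have "(real_of_int j - 1/2) * pi < p n * pi" "p n * pi < (real_of_int j + 1/2) * pi"
          using j False by (auto intro!: mult_strict_right_mono)
        then show "real_of_int j * pi - pi / 2 < \<phi>" "\<phi> < real_of_int j * pi + pi / 2"
          by (simp_all add: \<phi> algebra_simps)
      qed
      from shear_angle_cell[OF this, of t]
      have p': "real_of_int j < p'" "p' < real_of_int j + 1"
        by (simp_all add: p'_def pos_less_divide_eq pos_divide_less_eq)
      have not_int: "z \<notin> \<int>" if "real_of_int i < z" "z < real_of_int i + 1" for z i
        using that by (auto elim!: Ints_cases)
      have "p (Suc n) \<notin> \<int>"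
        by (rule not_int[of "j + k"]) (use p' in \<open>simp_all add: p_Suc\<close>)
      moreover have "p n + 1/2 \<notin> \<int>"
        by (rule not_int[of j]) (use j False in auto)
      moreover have "\<lfloor>p (Suc n)\<rfloor> = j + k"
        unfolding p_Suc using p' by (simp add: floor_eq_iff)
      ultimately show ?thesis by (simp add: j_def)
    qed
  qed
  have "bounded (range p)"
  proof -
    obtain C where "\<And>x. \<bar>\<theta> x\<bar> \<le> C"
      using bounded_range_circle_continuous[OF \<theta>] by (auto simp: bounded_iff)
    then have "\<bar>p n\<bar> \<le> C / pi" for n by (simp add: p_def divide_right_mono)
    then show ?thesis by (auto simp: bounded_iff)
  qed
  \<comment> \<open>The cotangent is the quotient of entries 1 and 0 of the decaying solution over
    \<open>2 ^ n * \<omega>\<close>. Where the sine vanishes the value is 0, which the later sign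
    conditions exclude.\<close>
  define r where "r n = cos (\<theta> (2 ^ n * \<omega>)) / sin (\<theta> (2 ^ n * \<omega>))" for n
  have sc: "2 * (sin (\<theta> (2 ^ n * \<omega>)) * cos (\<theta> (2 ^ n * \<omega>))) = sin (2 * pi * frac (p n))" for n
    by (simp add: sin_times_cos_frac p_def)
  have r_rec: "r (Suc n) + 1 / r n = E - f (2 ^ Suc n * \<omega>)" if "r n \<noteq> 0" "r (Suc n) \<noteq> 0" for n
    using that step[of "2 ^ n * \<omega>"] unfolding r_def Suc_orbit by (simp add: field_simps)
  have r_sign: "0 < s * r n" if "0 < s * sin (2 * pi * frac (p n))" for s n
    using that unfolding sc[symmetric] r_def
    by (auto simp: zero_less_mult_iff mult_less_0_iff zero_less_divide_iff divide_less_0_iff)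
  have one_side: "s * E' \<le> s * E" if "s = 1 \<or> s = - 1" "E' \<in> approximate_spectrum f"
    "\<And>n. n \<ge> N \<Longrightarrow> 0 < s * sin (2 * pi * frac (p n))" for s E' N
  proof (rule approximate_spectrum_on_one_side[OF f \<omega> that(2,1)])
    show sr: "0 < s * r n" if "n \<ge> N" for n
      using r_sign \<open>\<And>n. n \<ge> N \<Longrightarrow> 0 < s * sin (2 * pi * frac (p n))\<close> that by blast
    show "r (Suc n) + 1 / r n = E - f (2 ^ Suc n * \<omega>)" if "n \<ge> N" for n
      using sr[of n] sr[of "Suc n"] that by (intro r_rec) auto
  qed
  show False
  proof (rule bounded_angles_eventually_in_quadrant[OF \<open>bounded (range p)\<close>, of k])
    show "\<lfloor>p (Suc n)\<rfloor> = \<lfloor>p n + 1/2\<rfloor> + k" "p (Suc n) \<in> \<int> \<longleftrightarrow> p n + 1/2 \<in> \<int>" for n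
      using p[of n] by auto
  next
    \<comment> \<open>Positive quotients bound the approximate spectrum above by \<open>E\<close>,
      against \<open>b\<close>; in the other case negative ones bound it below, against
      \<open>a\<close>.\<close>
    fix N assume N: "\<And>n. n \<ge> N \<Longrightarrow> 0 < frac (p n) \<and> frac (p n) < 1/2"
    have "0 < 1 * sin (2 * pi * frac (p n))" if "n \<ge> N" for n
      using N[OF that] by (simp add: sin_gt_zero)
    from one_side[OF _ b this] show False using \<open>E < b\<close> by simp
  next
    fix N assume N: "\<And>n. n \<ge> N \<Longrightarrow> 1/2 < frac (p n)"
    have "0 < - 1 * sin (2 * pi * frac (p n))" if "n \<ge> N" for n
      using N[OF that] frac_lt_1[of "p n"] sin_lt_zero[of "2 * pi * frac (p n)"] by simp
    from one_side[OF _ a this] show False using \<open>a < E\<close> by simp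
  qed
qed

theorem theorem1p1:
  fixes f :: "real \<Rightarrow> real"
  assumes "circle_continuous f"
  shows "connected (almost_sure_essential_spectrum f)"
proof -
  have "is_interval (approximate_spectrum f)"
    unfolding is_interval_1
    using approximate_spectrum_no_gap[OF assms] by (metis less_le)
  then show ?thesis
    by (simp add: almost_sure_essential_spectrum_eq[OF assms] is_interval_connected)
qed

end
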